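(* Let $n\ge 1$ and let $S\subset\mathbb{R}^n$ be the union of a finite (nonempty) family of $n$-dimensional convex compact polyhedra. The following assertions are equivalent: (i) $S$ is connected by analytic paths. (ii) There exists a polynomial map $f:\mathbb{R}^{n+1}\to\mathbb{R}^n$ such that $f(\overline{B}_{n+1})=S$.
   Context: $\overline{B}_m$ denotes the closed unit ball of $\mathbb{R}^m$ centered at the origin. A map $\mathbb{R}^m\to\mathbb{R}^n$ is polynomial if each of its components is a polynomial with real coefficients. A semialgebraic set $S\subset\mathbb{R}^n$ is connected by analytic paths if for each pair of points $p_1,p_2\in S$ there exists a (real) analytic path $\alpha:[0,1]\to S$ (i.e. a map that extends to a real analytic map on an open neighborhood of $[0,1]$ in $\mathbb{R}$ with values in $\mathbb{R}^n$) such that $\alpha(0)=p_1$ and $\alpha(1)=p_2$. *)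

theory Defs
  imports "HOL-Analysis.Analysis"
begin

definition real_analytic_on :: "(real \<Rightarrow> 'a::real_normed_vector) \<Rightarrow> real set \<Rightarrow> bool"
    (infix "real'_analytic'_on" 50) where
  "f real_analytic_on U \<longleftrightarrow>
     (\<forall>t\<in>U. \<exists>r>0. \<exists>a :: nat \<Rightarrow> 'a. \<forall>s\<in>ball t r. (\<lambda>k. (s - t) ^ k *\<^sub>R a k) sums f s)"

text \<open>
  As for library paths, only the values of \<open>g\<close> on \<open>{0..1}\<close> matter. The extension \<open>h\<close>
  may leave the set that contains the path.
\<close>

definition analytic_path :: "(real \<Rightarrow> 'a::real_normed_vector) \<Rightarrow> bool" where
  "analytic_path g \<longleftrightarrow>
     (\<exists>U h. open U \<and> {0..1} \<subseteq> U \<and> h real_analytic_on U \<and> (\<forall>t\<in>{0..1}. h t = g t))"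

definition connected_by_analytic_paths :: "'a::real_normed_vector set \<Rightarrow> bool" where
  "connected_by_analytic_paths S \<longleftrightarrow>
     (\<forall>p\<in>S. \<forall>q\<in>S. \<exists>g. analytic_path g \<and> path_image g \<subseteq> S \<and> pathstart g = p \<and> pathfinish g = q)"

end

theory Submission
  imports Defs
begin

text \<open>
  A polynomial image of a ball is connected by analytic paths, because the image of a segment is
  parametrised by a polynomial. The work is in the converse: a union \<open>S\<close> of full-dimensional convex
  polyhedra that is connected by analytic paths has to be covered by one polynomial map that never
  leaves \<open>S\<close>.

  The map is built as a film. A ball can be mapped polynomially onto a cube
  (\<open>polynomial_image_ball_eq_cube\<close>); one coordinate of the cube is time \<open>t\<close>, the others form a
  parameter \<open>x\<close>. Each polyhedron is a finite union of convex hulls of \<open>n + 1\<close> vertices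
  (Caratheodory), and each of these is a polynomial image of the parameter cube
  (\<open>polynomial_image_cube_eq_convex_hull\<close>). At certain times the picture \<open>x \<mapsto> F (x, t)\<close> is to show one
  of these convex hulls; in between it shrinks into the interior of a polyhedron and travels to the
  next one.

  The film is glued from scenes that are called passages: polynomial families in \<open>x\<close> and \<open>t\<close>, for
  \<open>\<bar>t\<bar> \<le> 1\<close>, that are in one polyhedron for \<open>t \<le> 0\<close> and in another one for \<open>t \<ge> 0\<close>, at a distance of at
  least \<open>c * \<bar>t\<bar> ^ e\<close> from the complement. There are three kinds of them. A constant family leads from
  one polyhedron to another one that shares an interior point with it. A family that shrinks
  quadratically away from \<open>t = 0\<close> shows a subset of a polyhedron (\<open>passage_through_subset\<close>). And an
  analytic path that crosses from one polyhedron to another one, perhaps through a single common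
  vertex, may be replaced near the crossing by its Taylor polynomial of high order, because an
  analytic path that does not run inside a bounding hyperplane leaves it with some finite order
  (\<open>passage_along_analytic_path\<close>). A path that starts at a point outside all bounding hyperplanes has
  this property throughout, by the identity theorem, and so any two polyhedra are joined by a chain of
  passages (\<open>polyhedra_linked_by_passages\<close>).

  The gluing must not spoil the contact of finite order at the times when the picture touches the
  boundary of \<open>S\<close>. It uses polynomials that imitate step functions and agree with them to any
  prescribed order at all integers (\<open>exists_polynomial_step\<close>). Blended with such steps, consecutive
  scenes form a convex combination inside one convex polyhedron, up to an error that is smaller than
  the margin (\<open>polynomial_concatenation\<close>).
\<close>

section \<open>Polynomial functions\<close>

lemma polynomial_function_times_real:
  fixes f g :: "'a::real_normed_vector \<Rightarrow> real"
  shows "polynomial_function f \<Longrightarrow> polynomial_function g \<Longrightarrow> polynomial_function (\<lambda>x. f x * g x)"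
  using polynomial_function_mult[of f g] by simp

lemma polynomial_function_power_real:
  fixes f :: "'a::real_normed_vector \<Rightarrow> real"
  shows "polynomial_function f \<Longrightarrow> polynomial_function (\<lambda>x. f x ^ k)"
  by (induction k) (auto intro: polynomial_function_times_real)

lemma polynomial_function_comp:
  "polynomial_function g \<Longrightarrow> polynomial_function f \<Longrightarrow> polynomial_function (\<lambda>x. g (f x))"
  using polynomial_function_compose[of f g] by (simp add: o_def)

text \<open>
  A bounded linear form on the product splits as \<open>h (u, v) = h (u, 0) + h (0, v)\<close>.
\<close>

lemma polynomial_function_Pair:
  fixes f :: "'a::real_normed_vector \<Rightarrow> 'b::real_normed_vector"
    and g :: "'a \<Rightarrow> 'c::real_normed_vector"
  assumes "polynomial_function f" "polynomial_function g"
  shows "polynomial_function (\<lambda>x. (f x, g x))"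
  unfolding polynomial_function_def
proof (intro allI impI)
  fix h :: "'b \<times> 'c \<Rightarrow> real" assume h: "bounded_linear h"
  have split: "h (f x, g x) = h (f x, 0) + h (0, g x)" for x
    using linear_add[OF bounded_linear.linear[OF h], of "(f x, 0)" "(0, g x)"] by simp
  have "bounded_linear (\<lambda>u. h (u, 0))" "bounded_linear (\<lambda>v. h (0, v))"
    by (auto intro!: bounded_linear_compose[OF h] bounded_linear_Pair
        bounded_linear_ident bounded_linear_zero)
  then show "real_polynomial_function (h \<circ> (\<lambda>x. (f x, g x)))"
    unfolding real_polynomial_function_eq o_def split
    by (intro polynomial_function_add polynomial_function_comp[OF _ assms(1)]
        polynomial_function_comp[OF _ assms(2)] polynomial_function_bounded_linear)
qed

lemmas polynomial_function_intros =
  polynomial_function_const polynomial_function_id polynomial_function_add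
  polynomial_function_diff polynomial_function_minus polynomial_function_sum
  polynomial_function_times_real polynomial_function_power_real polynomial_function_mult
  polynomial_function_Pair

lemma polynomial_function_fst: "polynomial_function fst"
  and polynomial_function_snd: "polynomial_function snd"
  by (intro polynomial_function_bounded_linear bounded_linear_fst bounded_linear_snd)+

lemma polynomial_function_vec_nth: "polynomial_function (\<lambda>x :: real ^ 'm. x $ i)"
  by (intro polynomial_function_bounded_linear bounded_linear_vec_nth)

lemma continuous_on_compact_bound:
  fixes f :: "'a::topological_space \<Rightarrow> 'b::real_normed_vector"
  assumes "compact K" "continuous_on K f"
  obtains M where "M > 0" "\<And>x. x \<in> K \<Longrightarrow> norm (f x) \<le> M"
proof -
  have "bounded (f ` K)"
    using assms by (intro compact_imp_bounded compact_continuous_image)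
  then show ?thesis
    using that unfolding bounded_pos by auto
qed

lemma Lagrange_basis_polynomial:
  fixes U :: "real set"
  assumes "finite U"
  obtains L :: "real \<Rightarrow> real" where "polynomial_function L" "\<And>v. v \<in> U \<Longrightarrow> L v = (if v = u then 1 else 0)"
proof
  define L where "L = (\<lambda>t. \<Prod>v\<in>U - {u}. (t - v) / (u - v))"
  show "polynomial_function L"
    unfolding L_def real_polynomial_function_eq[symmetric]
    using assms by (intro real_polynomial_function_prod real_polynomial_function_divide)
      (auto simp: real_polynomial_function_eq)
  show "L v = (if v = u then 1 else 0)" if "v \<in> U" for v
    using that assms by (auto simp: L_def prod_zero_iff)
qed

text \<open>
  Approximate first, then correct the finitely many values by Lagrange interpolation. The
  correction is at most \<open>M\<close> times the first error, where \<open>M\<close> bounds the sum of the absolute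
  values of the Lagrange basis on \<open>K\<close>, so an initial error of \<open>e / (1 + M)\<close> is small enough.
\<close>

lemma Weierstrass_interpolating:
  fixes f :: "real \<Rightarrow> real"
  assumes "compact K" "continuous_on K f" "finite U" "U \<subseteq> K" "e > 0"
  obtains p where "polynomial_function p" "\<And>t. t \<in> K \<Longrightarrow> \<bar>p t - f t\<bar> \<le> e"
    "\<And>u. u \<in> U \<Longrightarrow> p u = f u"
proof -
  have "\<exists>L. polynomial_function L \<and> (\<forall>v\<in>U. L v = (if v = u then 1 else (0::real)))" for u
    using Lagrange_basis_polynomial[OF assms(3)] by metis
  then obtain L where L: "\<And>u. polynomial_function (L u)"
    "\<And>u v. v \<in> U \<Longrightarrow> L u v = (if v = u then 1 else (0::real))"
    by metis
  have "continuous_on K (\<lambda>t. \<Sum>u\<in>U. \<bar>L u t\<bar>)"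
    using L(1) by (intro continuous_intros continuous_on_polymonial_function)
  then obtain M where M: "M > 0" "\<And>t. t \<in> K \<Longrightarrow> norm (\<Sum>u\<in>U. \<bar>L u t\<bar>) \<le> M"
    using continuous_on_compact_bound[OF assms(1)] by metis
  define d where "d = e / (1 + M)"
  have "d > 0" using assms(5) M(1) by (simp add: d_def)
  obtain g where g: "real_polynomial_function g" "\<And>t. t \<in> K \<Longrightarrow> \<bar>f t - g t\<bar> < d"
    using Stone_Weierstrass_real_polynomial_function[OF assms(1,2) \<open>d > 0\<close>] by metis
  define p where "p = (\<lambda>t. g t + (\<Sum>u\<in>U. (f u - g u) * L u t))"
  show ?thesis
  proof
    show "polynomial_function p"
      unfolding p_def using g(1) L(1) assms(3)
      by (intro polynomial_function_intros) (auto simp: real_polynomial_function_eq)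
    show "p v = f v" if "v \<in> U" for v
    proof -
      have "(\<Sum>u\<in>U. (f u - g u) * L u v) = (\<Sum>u\<in>U. if v = u then f u - g u else 0)"
        using that L(2) by (intro sum.cong) auto
      then show ?thesis
        using that assms(3) by (simp add: p_def)
    qed
    show "\<bar>p t - f t\<bar> \<le> e" if t: "t \<in> K" for t
    proof -
      have "\<bar>\<Sum>u\<in>U. (f u - g u) * L u t\<bar> \<le> (\<Sum>u\<in>U. d * \<bar>L u t\<bar>)"
        using g(2) assms(4)
        by (intro order_trans[OF sum_abs] sum_mono) (auto simp: abs_mult less_imp_le subset_iff intro!: mult_right_mono)
      also have "\<dots> = d * (\<Sum>u\<in>U. \<bar>L u t\<bar>)"
        by (simp add: sum_distrib_left)
      also have "\<dots> \<le> d * M"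
        using M(2)[OF t] \<open>d > 0\<close> by (intro mult_left_mono) auto
      finally have "\<bar>p t - f t\<bar> \<le> d + d * M"
        using g(2)[OF t] by (simp add: p_def)
      also have "d + d * M = d * (1 + M)"
        by (simp add: algebra_simps)
      also have "\<dots> = e"
        using M(1) by (simp add: d_def)
      finally show ?thesis .
    qed
  qed
qed

lemma polynomial_function_Lipschitz_on_interval:
  fixes p :: "real \<Rightarrow> real"
  assumes "polynomial_function p"
  obtains C where "C > 0" "\<And>s t. s \<in> {a..b} \<Longrightarrow> t \<in> {a..b} \<Longrightarrow> \<bar>p s - p t\<bar> \<le> C * \<bar>s - t\<bar>"
proof -
  obtain p' where p': "real_polynomial_function p'" "\<And>x. (p has_real_derivative p' x) (at x)"
    using has_real_derivative_polynomial_function assms real_polynomial_function_eq by blast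
  obtain C where C: "C > 0" "\<And>x. x \<in> {a..b} \<Longrightarrow> norm (p' x) \<le> C"
    using continuous_on_compact_bound[of "{a..b}" p'] p'(1) real_polynomial_function_eq
      continuous_on_polymonial_function by (metis compact_Icc)
  have "\<bar>p s - p t\<bar> \<le> C * \<bar>s - t\<bar>" if "s \<in> {a..b}" "t \<in> {a..b}" for s t
    using field_differentiable_bound[OF convex_real_interval(5)
        has_field_derivative_at_within[OF p'(2)] C(2) that] by simp
  with C(1) show ?thesis using that by blast
qed

section \<open>Polynomial steps that are flat at the integers\<close>

text \<open>
  The cubic Hermite step. It fixes \<open>0\<close> and \<open>1\<close>, both with vanishing derivative, so iterating it
  squares the distance to these fixed points up to a constant factor: an approximate step function
  with exact values at some points becomes a step function that is flat there to any order.
\<close>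

definition smoothstep :: "real \<Rightarrow> real" where
  "smoothstep y = y\<^sup>2 * (3 - 2 * y)"

lemma smoothstep_bounds:
  assumes "-1/2 \<le> y" "y \<le> 3/2"
  shows "smoothstep y \<in> {0..1}"
proof -
  have "1 - smoothstep y = (1 - y)\<^sup>2 * (1 + 2 * y)"
    by (simp add: smoothstep_def power2_eq_square algebra_simps)
  moreover have "0 \<le> (1 - y)\<^sup>2 * (1 + 2 * y)" "0 \<le> y\<^sup>2 * (3 - 2 * y)"
    using assms by (auto intro!: mult_nonneg_nonneg)
  ultimately show ?thesis
    by (auto simp: smoothstep_def)
qed

lemma smoothstep_reflect: "smoothstep (1 - y) = 1 - smoothstep y"
  by (simp add: smoothstep_def power2_eq_square algebra_simps)

lemma smoothstep_iterate_bounds: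
  assumes "-1/2 \<le> y" "y \<le> 3/2"
  shows "(smoothstep ^^ Suc r) y \<in> {0..1}"
proof (induction r)
  case (Suc r)
  then show ?case
    using smoothstep_bounds[of "(smoothstep ^^ Suc r) y"] by auto
qed (use smoothstep_bounds[OF assms] in simp)

lemma smoothstep_iterate_reflect: "(smoothstep ^^ r) (1 - y) = 1 - (smoothstep ^^ r) y"
  by (induction r) (simp_all add: smoothstep_reflect)

text \<open>
  On \<open>{- 1/2..3/2}\<close> one has \<open>\<bar>3 - 2 * y\<bar> \<le> 4\<close>, hence \<open>4 * \<bar>smoothstep y\<bar> \<le> (4 * \<bar>y\<bar>)\<^sup>2\<close>.
  By the reflection \<open>y \<mapsto> 1 - y\<close> the same bound governs the approach to \<open>1\<close>.
\<close>

lemma smoothstep_iterate_flat: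
  assumes "-1/2 \<le> y" "y \<le> 3/2"
  shows "4 * \<bar>(smoothstep ^^ r) y\<bar> \<le> (4 * \<bar>y\<bar>) ^ (2 ^ r)"
proof (induction r)
  case (Suc r)
  define z where "z = (smoothstep ^^ r) y"
  have z: "-1/2 \<le> z" "z \<le> 3/2"
    using assms smoothstep_iterate_bounds[OF assms, of "r - 1"] by (cases r; simp add: z_def)+
  have "\<bar>smoothstep z\<bar> = z\<^sup>2 * \<bar>3 - 2 * z\<bar>"
    by (simp add: smoothstep_def abs_mult)
  also have "\<dots> \<le> z\<^sup>2 * 4"
    using z by (intro mult_left_mono) auto
  finally have "4 * \<bar>smoothstep z\<bar> \<le> (4 * \<bar>z\<bar>)\<^sup>2"
    by (simp add: power_mult_distrib)
  also have "\<dots> \<le> ((4 * \<bar>y\<bar>) ^ (2 ^ r))\<^sup>2"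
    using Suc by (intro power_mono) (auto simp: z_def)
  also have "\<dots> = (4 * \<bar>y\<bar>) ^ (2 ^ Suc r)"
    by (metis power_Suc2 power_mult)
  finally show ?case
    by (simp add: z_def)
qed simp

lemma polynomial_function_smoothstep_iterate:
  "polynomial_function p \<Longrightarrow> polynomial_function (\<lambda>t. (smoothstep ^^ r) (p t))"
proof (induction r)
  case (Suc r)
  then show ?case
    unfolding smoothstep_def funpow.simps o_def
    by (intro polynomial_function_intros)
qed simp

text \<open>
  A polynomial that moves from \<open>0\<close> to \<open>1\<close> between \<open>j\<close> and \<open>j + 1\<close>; outside this interval it
  deviates from its target by so little that the deviation even vanishes to order \<open>e\<close> at every
  integer. Let \<open>p\<close> approximate the clamped function \<open>t - j\<close> within \<open>1/8\<close> and agree with it at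
  the integers. As \<open>p\<close> is Lipschitz, its distance from the target on \<open>{i..i + 1}\<close> is at most
  \<open>2 * C * (t - i) * (i + 1 - t)\<close>. The iterated smooth step raises four times this distance, which
  is at most \<open>1/2\<close>, to a huge power; \<open>e\<close> of the factors give the flatness and the other ones give
  the small constant \<open>\<epsilon>\<close>.
\<close>

lemma exists_polynomial_step:
  fixes j N e :: nat
  assumes "j < N" "e > 0" "\<epsilon> > 0"
  obtains Y :: "real \<Rightarrow> real" where "polynomial_function Y"
    "\<And>t. t \<in> {0..real N} \<Longrightarrow> Y t \<in> {0..1}"
    "\<And>i. i \<le> j \<Longrightarrow> Y (real i) = 0"
    "\<And>i. j < i \<Longrightarrow> i \<le> N \<Longrightarrow> Y (real i) = 1"
    "\<And>i t. i < j \<Longrightarrow> t \<in> {real i..real i + 1} \<Longrightarrow>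
        \<bar>Y t\<bar> \<le> \<epsilon> * ((t - real i) * (real i + 1 - t)) ^ e"
    "\<And>i t. j < i \<Longrightarrow> i < N \<Longrightarrow> t \<in> {real i..real i + 1} \<Longrightarrow>
        \<bar>Y t - 1\<bar> \<le> \<epsilon> * ((t - real i) * (real i + 1 - t)) ^ e"
proof -
  \<comment> \<open>All integers are mapped to \<open>0\<close> or \<open>1\<close>, the fixed points of the smooth step.\<close>
  define \<phi> where "\<phi> = (\<lambda>t. max 0 (min 1 (t - real j)))"
  have cont: "continuous_on {0..real N} \<phi>"
    unfolding \<phi>_def by (intro continuous_intros)
  obtain p where p: "polynomial_function p"
    "\<And>t. t \<in> {0..real N} \<Longrightarrow> \<bar>p t - \<phi> t\<bar> \<le> 1/8"
    "\<And>u. u \<in> real ` {..N} \<Longrightarrow> p u = \<phi> u"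
    by (rule Weierstrass_interpolating[OF compact_Icc cont, of "real ` {..N}" "1/8"]) auto
  obtain C where C: "C > 0"
    "\<And>s t. s \<in> {0..real N} \<Longrightarrow> t \<in> {0..real N} \<Longrightarrow> \<bar>p s - p t\<bar> \<le> C * \<bar>s - t\<bar>"
    using polynomial_function_Lipschitz_on_interval[OF p(1)] by blast
  obtain r0 where r0: "(1/2::real) ^ r0 < \<epsilon> / (16 * C) ^ e"
    using real_arch_pow_inv[of "\<epsilon> / (16 * C) ^ e" "1/2"] C(1) assms(3) by auto
  define r where "r = r0 + e"
  have r: "r0 + e \<le> 2 ^ Suc r"
    using less_exp[of "Suc r"] unfolding r_def by linarith
  define Y where "Y = (\<lambda>t. (smoothstep ^^ Suc r) (p t))"
  have prange: "-1/2 \<le> p t" "p t \<le> 3/2" if "t \<in> {0..real N}" for t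
    using p(2)[OF that] unfolding \<phi>_def by linarith+
  \<comment> \<open>The estimate for both sides: \<open>z\<close> stands for the signed distance of \<open>p t\<close> from its target.\<close>
  have est: "\<bar>(smoothstep ^^ Suc r) z\<bar> \<le> \<epsilon> * ((t - real i) * (real i + 1 - t)) ^ e"
    if z: "\<bar>z\<bar> \<le> 1/8" "\<bar>z\<bar> \<le> C * (t - real i)" "\<bar>z\<bar> \<le> C * (real i + 1 - t)"
      and t: "t \<in> {real i..real i + 1}" for z t i
  proof -
    define w where "w = (t - real i) * (real i + 1 - t)"
    have "\<bar>z\<bar> \<le> 2 * C * w"
    proof (cases "t - real i \<le> 1/2")
      case True
      then have "(t - real i) * 1 \<le> (t - real i) * (2 * (real i + 1 - t))"
        using t by (intro mult_left_mono) auto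
      also have "\<dots> = 2 * w" by (simp add: w_def)
      finally have "C * (t - real i) \<le> C * (2 * w)"
        using C(1) by (intro mult_left_mono) auto
      with z(2) show ?thesis by simp
    next
      case False
      then have "1 * (real i + 1 - t) \<le> (2 * (t - real i)) * (real i + 1 - t)"
        using t by (intro mult_right_mono) auto
      also have "\<dots> = 2 * w" by (simp add: w_def)
      finally have "C * (real i + 1 - t) \<le> C * (2 * w)"
        using C(1) by (intro mult_left_mono) auto
      with z(3) show ?thesis by simp
    qed
    then have zw: "4 * \<bar>z\<bar> \<le> 8 * C * w" by simp
    have "w \<ge> 0" using t by (simp add: w_def)
    obtain k where k: "2 ^ Suc r = r0 + e + k"
      using r nat_le_iff_add by blast
    have "4 * \<bar>(smoothstep ^^ Suc r) z\<bar> \<le> (4 * \<bar>z\<bar>) ^ (r0 + e + k)"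
      using smoothstep_iterate_flat[of z "Suc r"] z(1) unfolding k by linarith
    also have "\<dots> = (4 * \<bar>z\<bar>) ^ r0 * (4 * \<bar>z\<bar>) ^ e * (4 * \<bar>z\<bar>) ^ k"
      by (simp add: power_add)
    also have "\<dots> \<le> (1/2) ^ r0 * (8 * C * w) ^ e * 1"
    proof (intro mult_mono)
      show "(4 * \<bar>z\<bar>) ^ r0 \<le> (1/2) ^ r0" "(4 * \<bar>z\<bar>) ^ e \<le> (8 * C * w) ^ e"
        using z(1) zw by (intro power_mono; simp)+
      show "(4 * \<bar>z\<bar>) ^ k \<le> 1"
        using z(1) by (intro power_le_one) auto
    qed (use C(1) \<open>w \<ge> 0\<close> in auto)
    also have "\<dots> \<le> (\<epsilon> / (16 * C) ^ e) * (8 * C * w) ^ e * 1"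
      using r0 C(1) \<open>w \<ge> 0\<close> by (intro mult_right_mono) auto
    also have "\<dots> \<le> (\<epsilon> / (16 * C) ^ e) * (16 * C * w) ^ e * 1"
      using assms(3) C(1) \<open>w \<ge> 0\<close> by (intro mult_left_mono mult_right_mono power_mono) auto
    also have "\<dots> = \<epsilon> * w ^ e"
      using C(1) by (simp add: power_mult_distrib)
    finally show ?thesis
      unfolding w_def using assms(3) by linarith
  qed
  have \<phi>0: "\<phi> t = 0" if "t \<le> real j" for t
    using that by (simp add: \<phi>_def)
  have \<phi>1: "\<phi> t = 1" if "real j + 1 \<le> t" for t
    using that by (simp add: \<phi>_def)
  have sm0: "(smoothstep ^^ r) 0 = 0" for r
    by (induction r) (simp_all add: smoothstep_def)
  have sm1: "(smoothstep ^^ r) 1 = 1" for r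
    by (induction r) (simp_all add: smoothstep_def)
  show ?thesis
  proof
    show "polynomial_function Y"
      unfolding Y_def by (intro polynomial_function_smoothstep_iterate p)
    show "Y t \<in> {0..1}" if "t \<in> {0..real N}" for t
      unfolding Y_def by (intro smoothstep_iterate_bounds prange that)
    show "Y (real i) = 0" if "i \<le> j" for i
      using that assms(1) p(3)[of "real i"] \<phi>0[of "real i"] unfolding Y_def
      by (simp add: sm0 del: funpow.simps)
    show "Y (real i) = 1" if "j < i" "i \<le> N" for i
      using that assms(1) p(3)[of "real i"] \<phi>1[of "real i"] unfolding Y_def
      by (simp add: sm1 del: funpow.simps)
    show "\<bar>Y t\<bar> \<le> \<epsilon> * ((t - real i) * (real i + 1 - t)) ^ e"
      if i: "i < j" and t: "t \<in> {real i..real i + 1}" for i t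
      unfolding Y_def
    proof (rule est[OF _ _ _ t])
      have r: "real i + 1 \<le> real j" "real j + 1 \<le> real N"
        using i assms(1) by linarith+
      have tN: "t \<in> {0..real N}" "real i \<in> {0..real N}" "real i + 1 \<in> {0..real N}"
        using t r by auto
      have "real i \<in> real ` {..N}" "real i + 1 \<in> real ` {..N}"
        using i assms(1) by (auto intro!: image_eqI[of _ _ "Suc i"])
      then have "p (real i) = 0" "p (real i + 1) = 0"
        using p(3)[of "real i"] p(3)[of "real i + 1"] \<phi>0[of "real i"] \<phi>0[of "real i + 1"] r by auto
      then show "\<bar>p t\<bar> \<le> C * (t - real i)" "\<bar>p t\<bar> \<le> C * (real i + 1 - t)"
        using C(2)[of t "real i"] C(2)[of t "real i + 1"] t tN by auto
      show "\<bar>p t\<bar> \<le> 1/8"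
        using p(2)[OF tN(1)] \<phi>0[of t] t r by auto
    qed
    show "\<bar>Y t - 1\<bar> \<le> \<epsilon> * ((t - real i) * (real i + 1 - t)) ^ e"
      if i: "j < i" "i < N" and t: "t \<in> {real i..real i + 1}" for i t
    proof -
      have r: "real j + 1 \<le> real i" "real i + 1 \<le> real N"
        using i by linarith+
      have tN: "t \<in> {0..real N}" "real i \<in> {0..real N}" "real i + 1 \<in> {0..real N}"
        using t r by auto
      have "real i \<in> real ` {..N}" "real i + 1 \<in> real ` {..N}"
        using i assms(1) by (auto intro!: image_eqI[of _ _ "Suc i"])
      then have "p (real i) = 1" "p (real i + 1) = 1"
        using p(3)[of "real i"] p(3)[of "real i + 1"] \<phi>1[of "real i"] \<phi>1[of "real i + 1"] r by auto
      then have "\<bar>1 - p t\<bar> \<le> C * (t - real i)" "\<bar>1 - p t\<bar> \<le> C * (real i + 1 - t)"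
        using C(2)[of "real i" t] C(2)[of "real i + 1" t] t tN by auto
      moreover have "\<bar>1 - p t\<bar> \<le> 1/8"
        using p(2)[OF tN(1)] \<phi>1[of t] t r by (simp add: abs_minus_commute)
      ultimately have "\<bar>(smoothstep ^^ Suc r) (1 - p t)\<bar> \<le> \<epsilon> * ((t - real i) * (real i + 1 - t)) ^ e"
        by (intro est t)
      then show ?thesis
        unfolding Y_def smoothstep_iterate_reflect by linarith
    qed
  qed
qed

section \<open>Concatenation of polynomial families\<close>

text \<open>
  The distance to the complement is a concave function on a convex set. This is stated with balls,
  which also covers radius \<open>0\<close>, that is, points of the boundary that belong to \<open>A\<close>.
\<close>

lemma cball_convex_combination_subset:
  fixes A :: "'a::real_normed_vector set"
  assumes "convex A" "cball p r \<subseteq> A" "cball q s \<subseteq> A" "0 \<le> u" "u \<le> 1" "0 \<le> r" "0 \<le> s"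
  shows "cball ((1 - u) *\<^sub>R p + u *\<^sub>R q) ((1 - u) * r + u * s) \<subseteq> A"
proof
  fix z
  define R where "R = (1 - u) * r + u * s"
  define v where "v = z - ((1 - u) *\<^sub>R p + u *\<^sub>R q)"
  define w where "w = (1 / R) *\<^sub>R v"
  assume "z \<in> cball ((1 - u) *\<^sub>R p + u *\<^sub>R q) ((1 - u) * r + u * s)"
  then have v: "norm v \<le> R"
    by (simp add: v_def R_def dist_norm norm_minus_commute)
  have "R \<ge> 0" using assms(4-7) by (simp add: R_def)
  have w: "norm w \<le> 1" "R *\<^sub>R w = v"
    using v \<open>R \<ge> 0\<close> by (cases "R = 0"; simp add: w_def divide_le_eq)+
  have "norm (r *\<^sub>R w) \<le> r * 1" "norm (s *\<^sub>R w) \<le> s * 1"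
    using assms(6,7) w(1) by (auto intro: mult_left_le)
  then have "p + r *\<^sub>R w \<in> A" "q + s *\<^sub>R w \<in> A"
    using assms(2,3) by (auto simp: subset_iff dist_norm)
  then have "(1 - u) *\<^sub>R (p + r *\<^sub>R w) + u *\<^sub>R (q + s *\<^sub>R w) \<in> A"
    using assms(1,4,5) by (intro convexD) auto
  also have "(1 - u) *\<^sub>R (p + r *\<^sub>R w) + u *\<^sub>R (q + s *\<^sub>R w) = ((1 - u) *\<^sub>R p + u *\<^sub>R q) + R *\<^sub>R w"
    by (simp add: R_def algebra_simps)
  also have "\<dots> = z" by (simp add: w(2) v_def)
  finally show "z \<in> A" .
qed

lemma sum_telescope_below:
  fixes a :: "nat \<Rightarrow> 'a::ab_group_add"
  shows "a 0 + (\<Sum>i<j. a (Suc i) - a i) = a j"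
  by (induction j) (auto simp: algebra_simps)

text \<open>
  Polynomial families \<open>Q 0, \<dots>, Q N\<close> are glued at the times \<open>0, \<dots>, N\<close>. Near time \<open>j\<close> the family \<open>Q j\<close>
  leads from \<open>A (j - 1)\<close> to \<open>A j\<close>, and it keeps a distance of at least \<open>c * \<bar>t - j\<bar> ^ e\<close> from the
  complements of these sets. With the flat steps \<open>Y i\<close> the glued map is
  \<open>F (x, t) = q 0 + (\<Sum>i<N. Y i t * (q (i + 1) - q i))\<close>, where \<open>q i\<close> is \<open>Q i\<close> moved to time \<open>i\<close>.
  If every \<open>Y i\<close> with \<open>i \<noteq> j\<close> were exactly \<open>0\<close> or \<open>1\<close> on \<open>{j..j + 1}\<close>, the sum would telescope to a
  convex combination of \<open>q j\<close> and \<open>q (j + 1)\<close>. This combination lies in \<open>A j\<close> with a margin of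
  at least \<open>c * ((t - j) * (j + 1 - t)) ^ e\<close>, and the steps are so flat that the true value stays
  within the margin.
\<close>

lemma polynomial_concatenation:
  fixes Q :: "nat \<Rightarrow> 'a::euclidean_space \<times> real \<Rightarrow> 'b::euclidean_space"
  assumes "compact X" "c > 0"
    and poly: "\<And>j. j \<le> N \<Longrightarrow> polynomial_function (Q j)"
    and conv: "\<And>j. j < N \<Longrightarrow> convex (A j)"
    and right: "\<And>j x t. j < N \<Longrightarrow> x \<in> X \<Longrightarrow> t \<in> {0..1} \<Longrightarrow> cball (Q j (x, t)) (c * t ^ e) \<subseteq> A j"
    and left: "\<And>j x t. j < N \<Longrightarrow> x \<in> X \<Longrightarrow> t \<in> {0..1} \<Longrightarrow> cball (Q (Suc j) (x, - t)) (c * t ^ e) \<subseteq> A j"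
  obtains F :: "'a \<times> real \<Rightarrow> 'b" where "polynomial_function F"
    "\<And>j x. j \<le> N \<Longrightarrow> x \<in> X \<Longrightarrow> F (x, real j) = Q j (x, 0)"
    "\<And>j x t. j < N \<Longrightarrow> x \<in> X \<Longrightarrow> t \<in> {real j..real j + 1} \<Longrightarrow> F (x, t) \<in> A j"
proof -
  define q where "q = (\<lambda>j (x, t). Q j (x, t - real j))"
  define D where "D = (\<lambda>j z. q (Suc j) z - q j z)"
  have q: "polynomial_function (q j)" if "j \<le> N" for j
    unfolding q_def case_prod_beta
    by (intro polynomial_function_comp[OF poly[OF that]] polynomial_function_intros
        polynomial_function_fst polynomial_function_snd)
  have D: "polynomial_function (D j)" if "j < N" for j
    unfolding D_def using that by (intro polynomial_function_intros q) auto
  have "\<exists>M>0. \<forall>j<N. \<forall>z \<in> X \<times> {0..real N}. norm (D j z) \<le> M"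
  proof -
    have "continuous_on (X \<times> {0..real N}) (\<lambda>z. \<Sum>j<N. norm (D j z))"
      using D by (intro continuous_intros continuous_on_polymonial_function) auto
    moreover have "compact (X \<times> {0..real N})"
      using assms(1) by (intro compact_Times) auto
    ultimately obtain M where M: "M > 0"
      "\<And>z. z \<in> X \<times> {0..real N} \<Longrightarrow> norm (\<Sum>j<N. norm (D j z)) \<le> M"
      using continuous_on_compact_bound by metis
    have "norm (D j z) \<le> M" if "j < N" "z \<in> X \<times> {0..real N}" for j z
    proof -
      have "norm (D j z) \<le> (\<Sum>j<N. norm (D j z))"
        using that(1) by (intro member_le_sum) auto
      with M(2)[OF that(2)] show ?thesis by simp
    qed
    with M(1) show ?thesis by blast
  qed
  then obtain M where M: "M > 0"
    "\<And>j z. j < N \<Longrightarrow> z \<in> X \<times> {0..real N} \<Longrightarrow> norm (D j z) \<le> M"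
    by blast
  define \<epsilon> where "\<epsilon> = c / (real (Suc N) * M)"
  have \<epsilon>: "\<epsilon> > 0" using M(1) assms(2) by (simp add: \<epsilon>_def)
  define w where "w = (\<lambda>i t. (t - real i) * (real i + 1 - t))"
  define step where "step = (\<lambda>j (Y :: real \<Rightarrow> real). polynomial_function Y \<and>
     (\<forall>t\<in>{0..real N}. Y t \<in> {0..1}) \<and> (\<forall>i\<le>N. Y (real i) = of_bool (j < i)) \<and>
     (\<forall>i t. i < N \<longrightarrow> i \<noteq> j \<longrightarrow> t \<in> {real i..real i + 1} \<longrightarrow>
        \<bar>Y t - of_bool (j < i)\<bar> \<le> \<epsilon> * w i t ^ Suc e))"
  have "\<exists>Y. step j Y" if j: "j < N" for j
  proof -
    obtain Y :: "real \<Rightarrow> real" where Y: "polynomial_function Y"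
    "\<And>t. t \<in> {0..real N} \<Longrightarrow> Y t \<in> {0..1}"
    "\<And>i. i \<le> j \<Longrightarrow> Y (real i) = 0"
    "\<And>i. j < i \<Longrightarrow> i \<le> N \<Longrightarrow> Y (real i) = 1"
    "\<And>i t. i < j \<Longrightarrow> t \<in> {real i..real i + 1} \<Longrightarrow> \<bar>Y t\<bar> \<le> \<epsilon> * w i t ^ Suc e"
    "\<And>i t. j < i \<Longrightarrow> i < N \<Longrightarrow> t \<in> {real i..real i + 1} \<Longrightarrow> \<bar>Y t - 1\<bar> \<le> \<epsilon> * w i t ^ Suc e"
      using exists_polynomial_step[OF j zero_less_Suc[of e] \<epsilon>] unfolding w_def by blast
    have "\<bar>Y t - of_bool (j < i)\<bar> \<le> \<epsilon> * w i t ^ Suc e"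
      if "i < N" "i \<noteq> j" "t \<in> {real i..real i + 1}" for i t
      using Y(5)[of i t] Y(6)[of i t] that by (cases "i < j") (simp_all del: power_Suc)
    then show ?thesis
      unfolding step_def using Y(1-4) by (intro exI[of _ Y]) (simp del: power_Suc)
  qed
  then obtain Y where Y_step: "\<And>j. j < N \<Longrightarrow> step j (Y j)"
    by metis
  have Y:
    "j < N \<Longrightarrow> polynomial_function (Y j)"
    "\<And>t. j < N \<Longrightarrow> t \<in> {0..real N} \<Longrightarrow> Y j t \<in> {0..1}"
    "\<And>i. j < N \<Longrightarrow> i \<le> N \<Longrightarrow> Y j (real i) = of_bool (j < i)"
    "\<And>i t. j < N \<Longrightarrow> i < N \<Longrightarrow> i \<noteq> j \<Longrightarrow> t \<in> {real i..real i + 1} \<Longrightarrow>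
       \<bar>Y j t - of_bool (j < i)\<bar> \<le> \<epsilon> * w i t ^ Suc e" for j
    using Y_step[of j] unfolding step_def by (simp_all del: power_Suc)
  define F where "F = (\<lambda>z. q 0 z + (\<Sum>i<N. Y i (snd z) *\<^sub>R D i z))"
  have partial: "q 0 z + (\<Sum>i<N. of_bool (i < j) *\<^sub>R D i z) = q j z" if "j \<le> N" for j z
  proof -
    have "(\<Sum>i<N. of_bool (i < j) *\<^sub>R D i z) = (\<Sum>i<j. D i z)"
      using that by (intro sum.mono_neutral_cong_right) auto
    then show ?thesis
      using sum_telescope_below[of "\<lambda>i. q i z" j] by (simp add: D_def)
  qed
  show ?thesis
  proof
    show "polynomial_function F"
      unfolding F_def
      by (intro polynomial_function_intros q D polynomial_function_comp[OF Y(1)]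
          polynomial_function_snd) auto
    show "F (x, real j) = Q j (x, 0)" if "j \<le> N" "x \<in> X" for j x
    proof -
      have "F (x, real j) = q 0 (x, real j) + (\<Sum>i<N. of_bool (i < j) *\<^sub>R D i (x, real j))"
        using Y(3) that by (simp add: F_def)
      also have "\<dots> = Q j (x, 0)"
        unfolding partial[OF that(1)] by (simp add: q_def)
      finally show ?thesis .
    qed
    show "F (x, t) \<in> A j" if j: "j < N" and x: "x \<in> X" and t: "t \<in> {real j..real j + 1}" for j x t
    proof -
      define a where "a = t - real j"
      define b where "b = real j + 1 - t"
      have ab: "a \<in> {0..1}" "b \<in> {0..1}" "w j t = a * b"
        using t by (auto simp: a_def b_def w_def)
      have "real (Suc j) \<le> real N"
        using j by (intro of_nat_mono) auto
      then have tN: "t \<in> {0..real N}" using t by auto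
      define u where "u = Y j t"
      have u: "0 \<le> u" "u \<le> 1" using Y(2)[OF j tN] by (auto simp: u_def)
      \<comment> \<open>Main term and error: on this interval only the step \<open>Y j\<close> is really moving.\<close>
      define m where "m = (1 - u) *\<^sub>R Q j (x, a) + u *\<^sub>R Q (Suc j) (x, - b)"
      define E where "E = (\<Sum>i\<in>{..<N} - {j}. (Y i t - of_bool (i < j)) *\<^sub>R D i (x, t))"
      have "F (x, t) = q j (x, t) + (\<Sum>i<N. (Y i t - of_bool (i < j)) *\<^sub>R D i (x, t))"
        using partial[of j "(x, t)", symmetric] j
        by (simp add: F_def scaleR_diff_left sum_subtractf)
      also have "\<dots> = q j (x, t) + u *\<^sub>R D j (x, t) + E"
        using j by (subst sum.remove[of _ j]) (auto simp: E_def u_def)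
      also have "q j (x, t) + u *\<^sub>R D j (x, t) = m"
        by (simp add: m_def D_def q_def a_def b_def algebra_simps)
      finally have F: "F (x, t) = m + E" .
      have "norm E \<le> (\<Sum>i\<in>{..<N} - {j}. \<epsilon> * w j t ^ Suc e * M)"
        unfolding E_def
      proof (intro order_trans[OF norm_sum] sum_mono)
        fix i assume "i \<in> {..<N} - {j}"
        then show "norm ((Y i t - of_bool (i < j)) *\<^sub>R D i (x, t)) \<le> \<epsilon> * w j t ^ Suc e * M"
          unfolding norm_scaleR using Y(4)[of i j t] M x tN j t \<epsilon> ab
          by (intro mult_mono) auto
      qed
      also have "\<dots> \<le> real (Suc N) * (\<epsilon> * w j t ^ Suc e * M)"
        using \<epsilon> M(1) ab j by (simp add: card_Diff_subset mult_right_mono)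
      also have "\<dots> = c * (a * b) ^ Suc e"
        using M(1) ab(3) by (simp add: \<epsilon>_def)
      finally have "norm E \<le> c * (a * b) ^ Suc e" .
      also have "\<dots> \<le> (1 - u) * (c * a ^ e) + u * (c * b ^ e)"
      proof -
        have "(a * b) ^ Suc e \<le> (a * b) ^ e"
          using ab by (intro power_decreasing) (auto intro: mult_le_one)
        moreover have "(a * b) ^ e \<le> a ^ e" "(a * b) ^ e \<le> b ^ e"
          using ab by (auto intro!: power_mono mult_left_le mult_left_le_one_le)
        ultimately have "c * (a * b) ^ Suc e \<le> c * a ^ e" "c * (a * b) ^ Suc e \<le> c * b ^ e"
          using assms(2) by auto
        then have "(1 - u) * (c * (a * b) ^ Suc e) + u * (c * (a * b) ^ Suc e)
            \<le> (1 - u) * (c * a ^ e) + u * (c * b ^ e)"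
          using u by (intro add_mono mult_left_mono[of "c * (a * b) ^ Suc e"]) auto
        then show ?thesis by (simp add: algebra_simps)
      qed
      finally have "m + E \<in> cball m ((1 - u) * (c * a ^ e) + u * (c * b ^ e))"
        by (simp add: dist_norm)
      also have "\<dots> \<subseteq> A j"
        unfolding m_def using conv[OF j] right[OF j x ab(1)] left[OF j x ab(2)] u ab assms(2)
        by (intro cball_convex_combination_subset) auto
      finally show ?thesis unfolding F .
    qed
  qed
qed

section \<open>Passages between convex sets\<close>

text \<open>
  A polynomial family, parametrised by \<open>X\<close>, that is in \<open>A\<close> for negative times and in \<open>B\<close> for positive
  times. The sets may meet in a single point only, so all that can be asked for is a margin of
  polynomial order in time: it vanishes at time \<open>0\<close>, but no perturbation of higher order leaves the
  sets.
\<close>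

definition passage :: "'a::euclidean_space set \<Rightarrow> 'b::euclidean_space set \<Rightarrow> ('a \<times> real \<Rightarrow> 'b) \<Rightarrow> 'b set \<Rightarrow> bool" where
  "passage X A Q B \<longleftrightarrow> polynomial_function Q \<and>
     (\<exists>c>0. \<exists>e. \<forall>x\<in>X. \<forall>t\<in>{0..1}. cball (Q (x, - t)) (c * t ^ e) \<subseteq> A \<and> cball (Q (x, t)) (c * t ^ e) \<subseteq> B)"

lemma passage_reverse:
  assumes "passage X A Q B"
  shows "passage X B (\<lambda>z. Q (fst z, - snd z)) A"
proof -
  have "polynomial_function Q"
    using assms by (simp add: passage_def)
  then have "polynomial_function (\<lambda>z. Q (fst z, - snd z))"
    by (rule polynomial_function_comp)
      (intro polynomial_function_intros polynomial_function_fst polynomial_function_snd)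
  moreover obtain c e where "c > 0" "\<forall>x\<in>X. \<forall>t\<in>{0..1}.
      cball (Q (x, - t)) (c * t ^ e) \<subseteq> A \<and> cball (Q (x, t)) (c * t ^ e) \<subseteq> B"
    using assms unfolding passage_def by blast
  ultimately show ?thesis
    unfolding passage_def by (intro conjI exI[of _ c] exI[of _ e]) simp_all
qed

lemma passage_through_common_interior:
  assumes "x \<in> interior A" "x \<in> interior B"
  shows "passage X A (\<lambda>_. x) B"
proof -
  have "x \<in> interior (A \<inter> B)"
    using assms by simp
  then obtain r where "r > 0" "cball x r \<subseteq> A \<inter> B"
    unfolding mem_interior_cball by blast
  then show ?thesis
    unfolding passage_def by (intro conjI polynomial_function_const exI[of _ r] exI[of _ 0]) auto
qed

text \<open>
  A passage from \<open>A\<close> to itself that shows the whole image of \<open>\<sigma>\<close> at time \<open>0\<close>: at other times this image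
  is shrunk towards an interior point, which gives a margin of order \<open>t\<^sup>2\<close>.
\<close>

lemma passage_through_subset:
  assumes "convex A" "p \<in> interior A" "polynomial_function \<sigma>" "\<sigma> ` X \<subseteq> A"
  shows "passage X A (\<lambda>z. (1 - (snd z)\<^sup>2) *\<^sub>R \<sigma> (fst z) + (snd z)\<^sup>2 *\<^sub>R p) A"
proof -
  obtain r where r: "r > 0" "cball p r \<subseteq> A"
    using assms(2) mem_interior_cball by blast
  have "cball ((1 - t\<^sup>2) *\<^sub>R \<sigma> x + t\<^sup>2 *\<^sub>R p) (r * t\<^sup>2) \<subseteq> A" if "x \<in> X" "t \<in> {0..1}" for x t
    using cball_convex_combination_subset[OF assms(1), of "\<sigma> x" 0 p r "t\<^sup>2"] that assms(4) r
    by (auto simp: power_le_one mult.commute)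
  moreover have "polynomial_function (\<lambda>z. (1 - (snd z)\<^sup>2) *\<^sub>R \<sigma> (fst z) + (snd z)\<^sup>2 *\<^sub>R p)"
    by (intro polynomial_function_intros polynomial_function_comp[OF assms(3)]
        polynomial_function_fst polynomial_function_snd)
  ultimately show ?thesis
    unfolding passage_def using r(1) by (intro conjI exI[of _ r] exI[of _ 2]) auto
qed

lemma passages_uniform_margin:
  fixes X :: "'a::euclidean_space set" and A :: "'i \<Rightarrow> 'b::euclidean_space set"
  assumes "finite J" "\<And>j. j \<in> J \<Longrightarrow> passage X (A j) (Q j) (B j)"
  shows "\<exists>c>0. \<exists>e. \<forall>j\<in>J. \<forall>x\<in>X. \<forall>t\<in>{0..1}.
    cball (Q j (x, - t)) (c * t ^ e) \<subseteq> A j \<and> cball (Q j (x, t)) (c * t ^ e) \<subseteq> B j"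
  using assms
proof (induction J rule: finite_induct)
  case (insert i J)
  obtain c e where ce: "c > 0" "\<And>j x t. j \<in> J \<Longrightarrow> x \<in> X \<Longrightarrow> t \<in> {0..1} \<Longrightarrow>
     cball (Q j (x, - t)) (c * t ^ e) \<subseteq> A j \<and> cball (Q j (x, t)) (c * t ^ e) \<subseteq> B j"
    using insert.IH insert.prems by blast
  obtain d k where dk: "d > 0" "\<And>x t. x \<in> X \<Longrightarrow> t \<in> {0..1} \<Longrightarrow>
     cball (Q i (x, - t)) (d * t ^ k) \<subseteq> A i \<and> cball (Q i (x, t)) (d * t ^ k) \<subseteq> B i"
    using insert.prems[OF insertI1] unfolding passage_def by blast
  have "cball (Q j (x, - t)) (min c d * t ^ (e + k)) \<subseteq> A j \<and> cball (Q j (x, t)) (min c d * t ^ (e + k)) \<subseteq> B j"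
    if "j \<in> insert i J" "x \<in> X" "t \<in> {0..1}" for j x t
  proof -
    have "min c d * t ^ (e + k) \<le> c * t ^ e" "min c d * t ^ (e + k) \<le> d * t ^ k"
      using that ce(1) dk(1) by (auto intro!: mult_mono power_decreasing)
    then have sub: "cball y (min c d * t ^ (e + k)) \<subseteq> cball y (c * t ^ e)"
      "cball y (min c d * t ^ (e + k)) \<subseteq> cball y (d * t ^ k)" for y :: 'b
      using subset_cball by blast+
    show ?thesis
    proof (cases "j \<in> J")
      case True
      show ?thesis
        using ce(2)[OF True that(2,3)] by (intro conjI order_trans[OF sub(1)]; blast)
    next
      case False
      then have "j = i" using that(1) by simp
      then show ?thesis
        using dk(2)[OF that(2,3)] unfolding \<open>j = i\<close> by (intro conjI order_trans[OF sub(2)]; blast)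
    qed
  qed
  then show ?case
    using ce(1) dk(1) by (intro exI[of _ "min c d"] conjI exI[of _ "e + k"]) auto
qed (auto intro: exI[of _ 1])

section \<open>Visiting all parts of a connected union\<close>

text \<open>
  Walks in a graph with vertices of type \<open>'s\<close> and labelled edges \<open>E\<close>; here the vertices are convex
  sets and the labels are passages.
\<close>

inductive walk :: "('s \<Rightarrow> 'q \<Rightarrow> 's \<Rightarrow> bool) \<Rightarrow> 's \<Rightarrow> ('s \<times> 'q \<times> 's) list \<Rightarrow> 's \<Rightarrow> bool" for E where
  walk_Nil: "walk E A [] A"
| walk_Cons: "E A q B \<Longrightarrow> walk E B ds C \<Longrightarrow> walk E A ((A, q, B) # ds) C"

lemma walk_append: "walk E A xs B \<Longrightarrow> walk E B ys C \<Longrightarrow> walk E A (xs @ ys) C"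
  by (induction rule: walk.induct) (auto intro: walk_Cons)

lemma walk_if_rtranclp:
  assumes "(\<lambda>A B. \<exists>q. E A q B)\<^sup>*\<^sup>* A B"
  shows "\<exists>ds. walk E A ds B"
  using assms
proof (induction rule: converse_rtranclp_induct)
  case base
  show ?case by (intro exI[of _ "[]"] walk_Nil)
next
  case (step A A')
  then show ?case using walk_Cons by metis
qed

lemma walk_steps:
  assumes "walk E A ds C" "i < length ds"
  shows "E (fst (ds ! i)) (fst (snd (ds ! i))) (snd (snd (ds ! i)))"
    and "Suc i < length ds \<Longrightarrow> snd (snd (ds ! i)) = fst (ds ! Suc i)"
    and "i = 0 \<Longrightarrow> fst (ds ! i) = A"
  using assms
proof (induction arbitrary: i rule: walk.induct)
  case (walk_Cons A q B ds C)
  { case 1 then show ?case using walk_Cons by (cases i) auto }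
  { case 2 then show ?case using walk_Cons by (cases i) auto }
  { case 3 then show ?case by simp }
qed simp_all

text \<open>
  The loops are attached one at a time: from the end of the walk found so far, strong connectedness
  leads on to the next loop.
\<close>

lemma walk_visiting_loops:
  assumes "finite T" "\<And>A q. (A, q) \<in> T \<Longrightarrow> E A q A"
    and "\<And>A q. (A, q) \<in> T \<Longrightarrow> A \<in> V"
    and "\<And>A B. A \<in> V \<Longrightarrow> B \<in> V \<Longrightarrow> (\<lambda>A B. \<exists>q. E A q B)\<^sup>*\<^sup>* A B"
    and "A0 \<in> V"
  shows "\<exists>ds B. B \<in> V \<and> walk E A0 ds B \<and> (\<forall>(A, q)\<in>T. (A, q, A) \<in> set ds)"
  using assms
proof (induction T rule: finite_induct)
  case empty
  then show ?case using walk_Nil by fastforce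
next
  case (insert d T)
  obtain A q where d: "d = (A, q)" by force
  have "\<exists>ds B. B \<in> V \<and> walk E A0 ds B \<and> (\<forall>(A, q)\<in>T. (A, q, A) \<in> set ds)"
    by (rule insert.IH) (use insert.prems in \<open>blast+\<close>)
  then obtain ds B where ds: "B \<in> V" "walk E A0 ds B" "\<forall>(A, q)\<in>T. (A, q, A) \<in> set ds"
    by blast
  have A: "A \<in> V" "E A q A" using insert.prems(1,2)[of A q] d by simp_all
  obtain ds' where "walk E B ds' A"
    using walk_if_rtranclp insert.prems(3) ds(1) A(1) by metis
  then have "walk E A0 (ds @ ds' @ [(A, q, A)]) A"
    using ds(2) walk_Cons[of E A q A "[]" A, OF A(2) walk_Nil] by (meson walk_append)
  then show ?case
    using A(1) ds(3) d by (intro exI[of _ "ds @ ds' @ [(A, q, A)]"] exI[of _ A]) auto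
qed

text \<open>
  A walk through all the prescribed passages in \<open>T\<close> is turned into one polynomial map by
  concatenation, after its finitely many passages have been given a common margin.
\<close>

lemma polynomial_map_visiting:
  fixes X :: "'a::euclidean_space set" and V :: "'b::euclidean_space set set"
  assumes "compact X" and "finite T" "T \<noteq> {}"
    and conv: "\<And>A. A \<in> V \<Longrightarrow> convex A"
    and stay: "\<And>A Q. (A, Q) \<in> T \<Longrightarrow> A \<in> V \<and> passage X A Q A"
    and conn: "\<And>A B. A \<in> V \<Longrightarrow> B \<in> V \<Longrightarrow> (\<lambda>A B. \<exists>Q. A \<in> V \<and> B \<in> V \<and> passage X A Q B)\<^sup>*\<^sup>* A B"
  obtains F N where "polynomial_function F" "F ` (X \<times> {0..real N}) \<subseteq> \<Union>V"
    "\<forall>(A, Q)\<in>T. \<exists>j\<le>N. \<forall>x\<in>X. F (x, real j) = Q (x, 0)"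
proof -
  define E where "E = (\<lambda>A Q B. A \<in> V \<and> B \<in> V \<and> passage X A Q B)"
  obtain A0 Q0 where T0: "(A0, Q0) \<in> T" using assms(3) by auto
  obtain ds B where ds: "walk E A0 ds B" "\<And>A Q. (A, Q) \<in> T \<Longrightarrow> (A, Q, A) \<in> set ds"
    using walk_visiting_loops[of T E V A0] assms(2) stay conn T0 unfolding E_def by blast
  define N where "N = length ds - 1"
  have len: "length ds = Suc N"
    using ds(2)[OF T0] by (cases ds) (auto simp: N_def)
  define Q where "Q = (\<lambda>i. fst (snd (ds ! i)))"
  define src where "src = (\<lambda>i. fst (ds ! i))"
  define tgt where "tgt = (\<lambda>i. snd (snd (ds ! i)))"
  have edge: "E (src i) (Q i) (tgt i)" if "i \<le> N" for i
    using walk_steps(1)[OF ds(1), of i] that len by (simp add: Q_def src_def tgt_def)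
  have match: "src (Suc i) = tgt i" if "i < N" for i
    using walk_steps(2)[OF ds(1), of i] that len by (simp add: src_def tgt_def)
  have "\<exists>c>0. \<exists>e. \<forall>j\<in>{..N}. \<forall>x\<in>X. \<forall>t\<in>{0..1}.
      cball (Q j (x, - t)) (c * t ^ e) \<subseteq> src j \<and> cball (Q j (x, t)) (c * t ^ e) \<subseteq> tgt j"
    by (rule passages_uniform_margin) (use edge in \<open>auto simp: E_def\<close>)
  then obtain c e where ce: "c > 0" "\<And>i x t. i \<in> {..N} \<Longrightarrow> x \<in> X \<Longrightarrow> t \<in> {0..1} \<Longrightarrow>
      cball (Q i (x, - t)) (c * t ^ e) \<subseteq> src i \<and> cball (Q i (x, t)) (c * t ^ e) \<subseteq> tgt i"
    by blast
  obtain F where F: "polynomial_function F"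
    "\<And>j x. j \<le> N \<Longrightarrow> x \<in> X \<Longrightarrow> F (x, real j) = Q j (x, 0)"
    "\<And>j x t. j < N \<Longrightarrow> x \<in> X \<Longrightarrow> t \<in> {real j..real j + 1} \<Longrightarrow> F (x, t) \<in> tgt j"
  proof (rule polynomial_concatenation[OF assms(1) ce(1), of N Q tgt e])
    show "polynomial_function (Q j)" if "j \<le> N" for j
      using edge[OF that] by (simp add: E_def passage_def)
    show "convex (tgt j)" if "j < N" for j
      using edge[of j] that conv by (simp add: E_def)
    show "cball (Q j (x, t)) (c * t ^ e) \<subseteq> tgt j" if "j < N" "x \<in> X" "t \<in> {0..1}" for j x t
      using ce(2)[of j x t] that by simp
    show "cball (Q (Suc j) (x, - t)) (c * t ^ e) \<subseteq> tgt j" if "j < N" "x \<in> X" "t \<in> {0..1}" for j x t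
      using ce(2)[of "Suc j" x t] match[of j] that by simp
  qed blast
  have "F (x, t) \<in> \<Union>V" if x: "x \<in> X" and t: "t \<in> {0..real N}" for x t
  proof (cases "N = 0")
    case True
    have "Q 0 (x, 0) \<in> cball (Q 0 (x, 0)) (c * 0 ^ e)" using ce(1) by simp
    also have "\<dots> \<subseteq> tgt 0" using ce(2)[of 0 x 0] x by simp
    finally show ?thesis
      using F(2)[of 0 x] t True x edge[of 0] by (auto simp: E_def)
  next
    case False
    define j where "j = min (N - 1) (nat \<lfloor>t\<rfloor>)"
    have "j < N" "t \<in> {real j..real j + 1}"
      using t False by (auto simp: j_def min_def) linarith+
    then show ?thesis
      using F(3) x edge[of j] by (auto simp: E_def)
  qed
  moreover have "\<exists>j\<le>N. \<forall>x\<in>X. F (x, real j) = Q' (x, 0)" if AQ: "(A, Q') \<in> T" for A Q'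
  proof -
    obtain j where "j < length ds" "ds ! j = (A, Q', A)"
      using ds(2)[OF AQ] by (metis in_set_conv_nth)
    then show ?thesis
      using F(2) len by (intro exI[of _ j]) (auto simp: Q_def)
  qed
  ultimately show ?thesis
    using F(1) by (intro that[of F N]) blast+
qed

section \<open>Real analytic paths\<close>

text \<open>
  At \<open>s + \<rho>\<close> the series converges, so its terms there are bounded by some \<open>K\<close>; at distance at most
  \<open>\<rho> / 2\<close> the tail is dominated by a geometric series.
\<close>

lemma power_series_remainder:
  fixes a :: "nat \<Rightarrow> 'a::banach" and f :: "real \<Rightarrow> 'a"
  assumes "r > 0" and series: "\<And>t. t \<in> ball s r \<Longrightarrow> (\<lambda>k. (t - s) ^ k *\<^sub>R a k) sums f t"
  obtains M \<delta> where "M > 0" "\<delta> > 0"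
    "\<And>t. \<bar>t - s\<bar> \<le> \<delta> \<Longrightarrow> norm (f t - (\<Sum>k<e. (t - s) ^ k *\<^sub>R a k)) \<le> M * \<bar>t - s\<bar> ^ e"
proof -
  define \<rho> where "\<rho> = r / 2"
  have \<rho>: "\<rho> > 0" "\<rho> < r" using assms(1) by (auto simp: \<rho>_def)
  have "(\<lambda>k. (s + \<rho> - s) ^ k *\<^sub>R a k) sums f (s + \<rho>)"
    using \<rho> by (intro series) (auto simp: dist_real_def)
  then have "(\<lambda>k. \<rho> ^ k *\<^sub>R a k) \<longlonglongrightarrow> 0"
    by (auto dest: sums_summable summable_LIMSEQ_zero)
  then have "Bseq (\<lambda>k. \<rho> ^ k *\<^sub>R a k)"
    by (rule convergent_imp_Bseq[OF convergentI])
  then obtain K where K: "K > 0" "\<And>k. norm (\<rho> ^ k *\<^sub>R a k) \<le> K"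
    unfolding Bseq_def by auto
  show ?thesis
  proof
    show "2 * K / \<rho> ^ e > 0" "\<rho> / 2 > 0" using K \<rho> by auto
    fix t assume t: "\<bar>t - s\<bar> \<le> \<rho> / 2"
    define h where "h = t - s"
    have "(\<lambda>k. h ^ k *\<^sub>R a k) sums f t"
      using t \<rho> unfolding h_def by (intro series) (auto simp: dist_real_def abs_minus_commute)
    then have tail: "(\<lambda>k. h ^ (k + e) *\<^sub>R a (k + e)) sums (f t - (\<Sum>k<e. h ^ k *\<^sub>R a k))"
      by (rule sums_split_initial_segment)
    have bound: "norm (h ^ (k + e) *\<^sub>R a (k + e)) \<le> K * (\<bar>h\<bar> / \<rho>) ^ e * (1/2) ^ k" for k
    proof -
      have "norm (h ^ (k + e) *\<^sub>R a (k + e)) = (\<bar>h\<bar> / \<rho>) ^ (k + e) * norm (\<rho> ^ (k + e) *\<^sub>R a (k + e))"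
        using \<rho> by (simp add: power_divide power_abs)
      also have "\<dots> \<le> ((\<bar>h\<bar> / \<rho>) ^ e * (1/2) ^ k) * K"
      proof (intro mult_mono K)
        have "(\<bar>h\<bar> / \<rho>) ^ k \<le> (1/2) ^ k"
          using t \<rho> by (intro power_mono) (auto simp: h_def divide_le_eq)
        then show "(\<bar>h\<bar> / \<rho>) ^ (k + e) \<le> (\<bar>h\<bar> / \<rho>) ^ e * (1/2) ^ k"
          using \<rho> by (simp add: power_add mult.commute mult_left_mono)
      qed (use \<rho> in auto)
      finally show ?thesis by (simp add: mult_ac)
    qed
    have geom: "(\<lambda>k. K * (\<bar>h\<bar> / \<rho>) ^ e * (1/2) ^ k) sums (K * (\<bar>h\<bar> / \<rho>) ^ e * 2)"
      using geometric_sums[of "1/2::real"] by (intro sums_mult) simp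
    have "norm (f t - (\<Sum>k<e. h ^ k *\<^sub>R a k)) \<le> K * (\<bar>h\<bar> / \<rho>) ^ e * 2"
      using norm_suminf_le[OF bound sums_summable[OF geom]] sums_unique[OF tail] sums_unique[OF geom]
      by simp
    then show "norm (f t - (\<Sum>k<e. (t - s) ^ k *\<^sub>R a k)) \<le> 2 * K / \<rho> ^ e * \<bar>t - s\<bar> ^ e"
      by (simp add: h_def power_divide mult_ac)
  qed
qed

lemma real_analytic_on_isCont:
  fixes f :: "real \<Rightarrow> 'a::banach"
  assumes "f real_analytic_on U" "s \<in> U"
  shows "isCont f s"
proof -
  obtain r a where ra: "r > 0" "\<And>t. t \<in> ball s r \<Longrightarrow> (\<lambda>k. (t - s) ^ k *\<^sub>R a k) sums f t"
    using assms unfolding real_analytic_on_def by blast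
  obtain M \<delta> where M: "M > 0" "\<delta> > 0" "\<And>t. \<bar>t - s\<bar> \<le> \<delta> \<Longrightarrow> norm (f t - a 0) \<le> M * \<bar>t - s\<bar>"
    using power_series_remainder[OF ra, of 1] by auto
  have fs: "f s = a 0"
    using M(3)[of s] M(2) by simp
  have "\<forall>\<^sub>F t in at s. norm (f t - f s) \<le> M * \<bar>t - s\<bar>"
    unfolding eventually_at fs
    by (rule exI[of _ \<delta>]) (simp add: dist_real_def M)
  moreover have "((\<lambda>t. M * \<bar>t - s\<bar>) \<longlongrightarrow> 0) (at s)"
    by (auto intro!: tendsto_eq_intros)
  ultimately have "((\<lambda>t. f t - f s) \<longlongrightarrow> 0) (at s)"
    by (rule Lim_null_comparison)
  then show ?thesis
    unfolding isCont_def by (rule LIM_zero_cancel)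
qed

lemma eventually_abs_le_at:
  fixes s :: real
  assumes "d > 0"
  shows "\<forall>\<^sub>F t in at s. \<bar>t - s\<bar> \<le> d"
  unfolding eventually_at using assms by (auto simp: dist_real_def intro!: exI[of _ d])

text \<open>
  Either all coefficients vanish, or the first nonzero one dominates near \<open>s\<close>. Saying
  \<open>\<bar>t - s\<bar> ^ k \<le> \<bar>\<phi> t\<bar>\<close> for all large \<open>k\<close> hides the constant, since \<open>\<bar>t - s\<bar> \<le> c\<close> near \<open>s\<close>, and lets
  finitely many such statements be combined into one with a common exponent.
\<close>

lemma real_analytic_zero_or_finite_order:
  fixes \<phi> :: "real \<Rightarrow> real"
  assumes "\<phi> real_analytic_on U" "s \<in> U"
  shows "(\<forall>\<^sub>F t in nhds s. \<phi> t = 0) \<or> (\<forall>\<^sub>F k in sequentially. \<forall>\<^sub>F t in at s. \<bar>t - s\<bar> ^ k \<le> \<bar>\<phi> t\<bar>)"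
proof -
  obtain r a where ra: "r > 0" "\<And>t. t \<in> ball s r \<Longrightarrow> (\<lambda>k. (t - s) ^ k *\<^sub>R a k) sums \<phi> t"
    using assms unfolding real_analytic_on_def by blast
  show ?thesis
  proof (cases "\<forall>k. a k = 0")
    case True
    have "\<phi> t = 0" if "t \<in> ball s r" for t
      using sums_unique[OF ra(2)[OF that]] True by simp
    then have "\<forall>\<^sub>F t in nhds s. \<phi> t = 0"
      using ra(1) unfolding eventually_nhds by (intro exI[of _ "ball s r"]) auto
    then show ?thesis ..
  next
    case False
    define e where "e = (LEAST k. a k \<noteq> 0)"
    have e: "a e \<noteq> 0" "\<And>k. k < e \<Longrightarrow> a k = 0"
      using False LeastI_ex[of "\<lambda>k. a k \<noteq> 0"] not_less_Least[of _ "\<lambda>k. a k \<noteq> 0"] unfolding e_def by blast+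
    obtain M \<delta> where M: "M > 0" "\<delta> > 0" "\<And>t. \<bar>t - s\<bar> \<le> \<delta> \<Longrightarrow>
        norm (\<phi> t - (\<Sum>k<Suc e. (t - s) ^ k *\<^sub>R a k)) \<le> M * \<bar>t - s\<bar> ^ Suc e"
      using power_series_remainder[OF ra] by metis
    define c where "c = \<bar>a e\<bar> / (M + 1)"
    have c: "c > 0" "\<bar>a e\<bar> = c * (M + 1)" using e(1) M(1) by (auto simp: c_def)
    have key: "\<forall>\<^sub>F t in at s. \<bar>t - s\<bar> ^ k \<le> \<bar>\<phi> t\<bar>" if "k \<ge> Suc e" for k
      using eventually_abs_le_at[of \<delta> s, OF M(2)] eventually_abs_le_at[of c s, OF c(1)]
        eventually_abs_le_at[of 1 s, OF zero_less_one]
    proof eventually_elim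
      case (elim t)
      have "(\<Sum>k<Suc e. (t - s) ^ k *\<^sub>R a k) = (t - s) ^ e * a e"
        using e(2) by simp
      then have "\<bar>\<phi> t - (t - s) ^ e * a e\<bar> \<le> M * \<bar>t - s\<bar> ^ Suc e"
        using M(3)[OF elim(1)] by simp
      moreover have "\<bar>(t - s) ^ e * a e\<bar> = \<bar>t - s\<bar> ^ e * c + M * (\<bar>t - s\<bar> ^ e * c)"
        by (simp add: abs_mult power_abs c(2) algebra_simps)
      moreover have "\<bar>t - s\<bar> ^ Suc e \<le> \<bar>t - s\<bar> ^ e * c"
        using mult_right_mono[OF elim(2), of "\<bar>t - s\<bar> ^ e"] by (simp add: mult.commute)
      moreover from this have "M * \<bar>t - s\<bar> ^ Suc e \<le> M * (\<bar>t - s\<bar> ^ e * c)"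
        using M(1) by (intro mult_left_mono) auto
      moreover have "\<bar>t - s\<bar> ^ k \<le> \<bar>t - s\<bar> ^ Suc e"
        using that elim(3) by (intro power_decreasing) auto
      ultimately show ?case by linarith
    qed
    then show ?thesis
      unfolding eventually_sequentially by blast
  qed
qed

text \<open>
  The identity theorem. The points around which \<open>\<phi>\<close> vanishes identically and the points that have
  a punctured neighbourhood without zeros form two disjoint open sets that cover the connected set \<open>I\<close>.
\<close>

lemma real_analytic_finite_order:
  fixes \<phi> :: "real \<Rightarrow> real"
  assumes "\<phi> real_analytic_on U" "connected I" "I \<subseteq> U" "p \<in> I" "\<phi> p \<noteq> 0" "s \<in> I"
  shows "\<forall>\<^sub>F k in sequentially. \<forall>\<^sub>F t in at s. \<bar>t - s\<bar> ^ k \<le> \<bar>\<phi> t\<bar>"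
proof -
  define Z where "Z = {s. \<forall>\<^sub>F t in nhds s. \<phi> t = 0}"
  define W where "W = {s. \<exists>\<delta>>0. \<forall>t\<in>ball s \<delta> - {s}. \<phi> t \<noteq> 0}"
  have order: "\<forall>\<^sub>F k in sequentially. \<forall>\<^sub>F t in at s. \<bar>t - s\<bar> ^ k \<le> \<bar>\<phi> t\<bar>" if "s \<in> I" "s \<notin> Z" for s
    using real_analytic_zero_or_finite_order[OF assms(1), of s] that assms(3) unfolding Z_def by blast
  have "open Z"
    unfolding Z_def eventually_nhds by (subst open_subopen) blast
  moreover have "open W"
    unfolding open_contains_ball
  proof
    fix s assume "s \<in> W"
    then obtain \<delta> where \<delta>: "\<delta> > 0" "\<forall>t\<in>ball s \<delta> - {s}. \<phi> t \<noteq> 0"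
      unfolding W_def by blast
    have "ball s \<delta> \<subseteq> W"
    proof
      fix u assume u: "u \<in> ball s \<delta>"
      show "u \<in> W"
      proof (cases "u = s")
        case False
        then have "open (ball s \<delta> - {s})" "u \<in> ball s \<delta> - {s}" using u by auto
        then obtain \<eta> where "\<eta> > 0" "ball u \<eta> \<subseteq> ball s \<delta> - {s}"
          unfolding open_contains_ball by blast
        then show ?thesis using \<delta>(2) unfolding W_def by blast
      qed (use \<open>s \<in> W\<close> in simp)
    qed
    then show "\<exists>e>0. ball s e \<subseteq> W" using \<delta>(1) by blast
  qed
  moreover have "I \<subseteq> Z \<union> W"
  proof
    fix s assume "s \<in> I"
    show "s \<in> Z \<union> W"
    proof (cases "s \<in> Z")
      case False
      obtain k where "\<forall>\<^sub>F t in at s. \<bar>t - s\<bar> ^ k \<le> \<bar>\<phi> t\<bar>"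
        using order[OF \<open>s \<in> I\<close> False] unfolding eventually_sequentially by blast
      then obtain d where d: "d > 0" "\<And>t. t \<noteq> s \<Longrightarrow> dist t s < d \<Longrightarrow> \<bar>t - s\<bar> ^ k \<le> \<bar>\<phi> t\<bar>"
        unfolding eventually_at by blast
      have "\<phi> t \<noteq> 0" if "t \<in> ball s d - {s}" for t
      proof -
        have "0 < \<bar>t - s\<bar> ^ k" using that by simp
        also have "\<dots> \<le> \<bar>\<phi> t\<bar>" using that d(2)[of t] by (auto simp: dist_commute)
        finally show ?thesis by simp
      qed
      then show ?thesis using d(1) unfolding W_def by blast
    qed simp
  qed
  moreover have "Z \<inter> W \<inter> I = {}"
  proof -
    have False if "s \<in> Z" "s \<in> W" for s
    proof -
      have "\<forall>\<^sub>F t in at s. \<phi> t = 0"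
        using that(1) unfolding Z_def eventually_at_filter by (auto elim: eventually_mono)
      moreover have "\<forall>\<^sub>F t in at s. \<phi> t \<noteq> 0"
        using that(2) unfolding W_def eventually_at by (auto simp: dist_commute)
      ultimately have "\<forall>\<^sub>F t in at s. False"
        by eventually_elim auto
      then show False by simp
    qed
    then show ?thesis by blast
  qed
  ultimately have "Z \<inter> I = {} \<or> W \<inter> I = {}"
    using connectedD[OF assms(2)] by metis
  moreover have "p \<notin> Z"
    using assms(5) unfolding Z_def by (auto dest: eventually_nhds_x_imp_x)
  ultimately have "s \<notin> Z"
    using \<open>I \<subseteq> Z \<union> W\<close> assms(4,6) by blast
  with order assms(6) show ?thesis by blast
qed

lemma real_analytic_on_affine_form:
  fixes h :: "real \<Rightarrow> 'a::real_inner"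
  assumes "h real_analytic_on U"
  shows "(\<lambda>t. b - v \<bullet> h t) real_analytic_on U"
  unfolding real_analytic_on_def
proof
  fix s assume "s \<in> U"
  then obtain r a where ra: "r > 0" "\<And>t. t \<in> ball s r \<Longrightarrow> (\<lambda>k. (t - s) ^ k *\<^sub>R a k) sums h t"
    using assms unfolding real_analytic_on_def by blast
  have "(\<lambda>k. (t - s) ^ k *\<^sub>R ((if k = 0 then b else 0) - v \<bullet> a k)) sums (b - v \<bullet> h t)"
    if "t \<in> ball s r" for t
  proof -
    have "(\<lambda>k. v \<bullet> ((t - s) ^ k *\<^sub>R a k)) sums (v \<bullet> h t)"
      using bounded_linear.sums[OF bounded_linear_inner_right ra(2)[OF that]] .
    moreover have "(\<lambda>k. if k = 0 then b else 0) sums b"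
      using sums_single[of 0 "\<lambda>_. b"] by simp
    ultimately have diff: "(\<lambda>k. (if k = 0 then b else 0) - v \<bullet> ((t - s) ^ k *\<^sub>R a k)) sums (b - v \<bullet> h t)"
      by (intro sums_diff)
    have eq: "(if k = 0 then b else 0) - v \<bullet> ((t - s) ^ k *\<^sub>R a k) =
       (t - s) ^ k *\<^sub>R ((if k = 0 then b else 0) - v \<bullet> a k)" for k
      by (cases k) (simp_all add: right_diff_distrib del: power_Suc)
    show ?thesis using diff unfolding eq .
  qed
  then have "\<forall>t\<in>ball s r. (\<lambda>k. (t - s) ^ k *\<^sub>R ((if k = 0 then b else 0) - v \<bullet> a k)) sums (b - v \<bullet> h t)"
    by blast
  with ra(1) show "\<exists>r>0. \<exists>a. \<forall>t\<in>ball s r. (\<lambda>k. (t - s) ^ k *\<^sub>R a k) sums (b - v \<bullet> h t)"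
    by (intro exI[of _ r] conjI exI[of _ "\<lambda>k. (if k = 0 then b else 0) - v \<bullet> a k"])
qed

lemma polyhedron_as_inequalities:
  assumes "polyhedron P"
  obtains L where "finite L" "\<And>v b. (v, b) \<in> L \<Longrightarrow> v \<noteq> 0" "P = {x. \<forall>(v, b)\<in>L. v \<bullet> x \<le> b}"
proof -
  obtain F where F: "finite F" "P = \<Inter>F" "\<forall>h\<in>F. \<exists>v b. v \<noteq> 0 \<and> h = {x. v \<bullet> x \<le> b}"
    using assms unfolding polyhedron_def by blast
  then obtain V c where Vc: "\<And>h. h \<in> F \<Longrightarrow> V h \<noteq> 0 \<and> h = {x. V h \<bullet> x \<le> c h}"
    by metis
  have "P = {x. \<forall>(v, b)\<in>(\<lambda>h. (V h, c h)) ` F. v \<bullet> x \<le> b}"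
    using F(2) Vc by auto
  moreover have "finite ((\<lambda>h. (V h, c h)) ` F)" using F(1) by simp
  moreover have "v \<noteq> 0" if "(v, b) \<in> (\<lambda>h. (V h, c h)) ` F" for v b
    using that Vc by auto
  ultimately show ?thesis
    using that by blast
qed

section \<open>Analytic paths through polyhedra\<close>

text \<open>
  One exponent is spent to absorb the factor \<open>norm v\<close> that relates the slack of the inequality to the
  distance from its boundary.
\<close>

lemma halfspace_margin:
  fixes h :: "real \<Rightarrow> 'a::real_inner"
  assumes "\<forall>\<^sub>F k in sequentially. \<forall>\<^sub>F t in at s. \<bar>t - s\<bar> ^ k \<le> \<bar>b - v \<bullet> h t\<bar>"
  shows "\<forall>\<^sub>F k in sequentially. \<forall>\<^sub>F t in at s.
    v \<bullet> h t \<le> b \<longrightarrow> cball (h t) (\<bar>t - s\<bar> ^ k) \<subseteq> {x. v \<bullet> x \<le> b}"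
proof -
  obtain K where K: "\<And>k. k \<ge> K \<Longrightarrow> \<forall>\<^sub>F t in at s. \<bar>t - s\<bar> ^ k \<le> \<bar>b - v \<bullet> h t\<bar>"
    using assms unfolding eventually_sequentially by blast
  have "\<forall>\<^sub>F t in at s. v \<bullet> h t \<le> b \<longrightarrow> cball (h t) (\<bar>t - s\<bar> ^ k) \<subseteq> {x. v \<bullet> x \<le> b}"
    if k: "k \<ge> Suc K" for k
  proof -
    obtain j where j: "k = Suc j" "j \<ge> K"
      using k Suc_le_D by blast
    have "\<forall>\<^sub>F t in at s. \<bar>t - s\<bar> \<le> 1 / (norm v + 1)"
      by (intro eventually_abs_le_at) (simp add: add_nonneg_pos)
    with K[OF j(2)] show ?thesis
    proof eventually_elim
      case t: (elim t)
      have "norm v * \<bar>t - s\<bar> \<le> norm v * (1 / (norm v + 1))"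
        using t(2) by (intro mult_left_mono) auto
      also have "\<dots> \<le> 1"
        by (simp add: divide_le_eq add_nonneg_pos)
      finally have "norm v * \<bar>t - s\<bar> * \<bar>t - s\<bar> ^ j \<le> 1 * \<bar>t - s\<bar> ^ j"
        by (intro mult_right_mono) auto
      then have small: "norm v * \<bar>t - s\<bar> ^ k \<le> \<bar>b - v \<bullet> h t\<bar>"
        using t(1) j(1) by (simp add: mult.assoc)
      show "v \<bullet> h t \<le> b \<longrightarrow> cball (h t) (\<bar>t - s\<bar> ^ k) \<subseteq> {x. v \<bullet> x \<le> b}"
      proof (intro impI subsetI CollectI)
        fix x assume b: "v \<bullet> h t \<le> b" and "x \<in> cball (h t) (\<bar>t - s\<bar> ^ k)"
        then have "norm (x - h t) \<le> \<bar>t - s\<bar> ^ k"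
          by (simp add: dist_norm norm_minus_commute)
        then have "norm v * norm (x - h t) \<le> norm v * \<bar>t - s\<bar> ^ k"
          by (intro mult_left_mono) auto
        moreover have "v \<bullet> (x - h t) \<le> norm v * norm (x - h t)"
          by (rule norm_cauchy_schwarz)
        ultimately show "v \<bullet> x \<le> b"
          using small b by (simp add: inner_diff_right)
      qed
    qed
  qed
  then show ?thesis
    unfolding eventually_sequentially by blast
qed

lemma polyhedron_margin:
  fixes h :: "real \<Rightarrow> 'a::real_inner"
  assumes "finite L" and P: "P = {x. \<forall>(v, b)\<in>L. v \<bullet> x \<le> b}"
    and "\<And>v b. (v, b) \<in> L \<Longrightarrow> \<forall>\<^sub>F k in sequentially. \<forall>\<^sub>F t in at s. \<bar>t - s\<bar> ^ k \<le> \<bar>b - v \<bullet> h t\<bar>"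
  shows "\<forall>\<^sub>F k in sequentially. \<forall>\<^sub>F t in at s. h t \<in> P \<longrightarrow> cball (h t) (\<bar>t - s\<bar> ^ k) \<subseteq> P"
proof -
  have P': "P = {x. \<forall>f\<in>L. fst f \<bullet> x \<le> snd f}"
    unfolding P by auto
  have "\<forall>\<^sub>F k in sequentially. \<forall>f\<in>L. \<forall>\<^sub>F t in at s.
      fst f \<bullet> h t \<le> snd f \<longrightarrow> cball (h t) (\<bar>t - s\<bar> ^ k) \<subseteq> {x. fst f \<bullet> x \<le> snd f}"
    using assms(3) by (intro eventually_ball_finite assms(1) ballI halfspace_margin) auto
  then have "\<forall>\<^sub>F k in sequentially. \<forall>\<^sub>F t in at s. \<forall>f\<in>L.
      fst f \<bullet> h t \<le> snd f \<longrightarrow> cball (h t) (\<bar>t - s\<bar> ^ k) \<subseteq> {x. fst f \<bullet> x \<le> snd f}"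
    by (simp add: eventually_ball_finite_distrib[OF assms(1)])
  then show ?thesis
  proof eventually_elim
    case (elim k)
    then show ?case
    proof eventually_elim
      case (elim t)
      show ?case
      proof
        assume "h t \<in> P"
        then have "\<forall>f\<in>L. cball (h t) (\<bar>t - s\<bar> ^ k) \<subseteq> {x. fst f \<bullet> x \<le> snd f}"
          using elim unfolding P' by simp
        then show "cball (h t) (\<bar>t - s\<bar> ^ k) \<subseteq> P"
          unfolding P' by blast
      qed
    qed
  qed
qed

text \<open>
  The Taylor polynomial of \<open>h\<close> at \<open>s\<close> of order \<open>k\<close> differs from \<open>h\<close> by \<open>M * \<bar>t - s\<bar> ^ (k + 1)\<close>, which
  is less than half of the margin \<open>\<bar>t - s\<bar> ^ k\<close> of the path near \<open>s\<close>. Rescaling time by \<open>\<delta>\<close> makes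
  this hold on the whole interval that a passage requires.
\<close>

lemma passage_along_analytic_path:
  fixes h :: "real \<Rightarrow> 'b::euclidean_space" and X :: "'a::euclidean_space set"
  assumes "h real_analytic_on U" "s \<in> U" "closed A" "closed B"
    and "\<forall>\<^sub>F k in sequentially. \<forall>\<^sub>F t in at s. h t \<in> A \<longrightarrow> cball (h t) (\<bar>t - s\<bar> ^ k) \<subseteq> A"
    and "\<forall>\<^sub>F k in sequentially. \<forall>\<^sub>F t in at s. h t \<in> B \<longrightarrow> cball (h t) (\<bar>t - s\<bar> ^ k) \<subseteq> B"
    and "\<forall>\<^sub>F t in at_left s. h t \<in> A" "\<forall>\<^sub>F t in at_right s. h t \<in> B"
  shows "\<exists>Q. passage X A Q B"
proof -
  have "\<forall>\<^sub>F k::nat in sequentially. k > 0"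
    by (rule eventually_gt_at_top)
  with assms(5,6) have "\<forall>\<^sub>F k in sequentially. k > 0 \<and>
      (\<forall>\<^sub>F t in at s. h t \<in> A \<longrightarrow> cball (h t) (\<bar>t - s\<bar> ^ k) \<subseteq> A) \<and>
      (\<forall>\<^sub>F t in at s. h t \<in> B \<longrightarrow> cball (h t) (\<bar>t - s\<bar> ^ k) \<subseteq> B)"
    by eventually_elim auto
  then obtain k where k: "k > 0"
      "\<forall>\<^sub>F t in at s. h t \<in> A \<longrightarrow> cball (h t) (\<bar>t - s\<bar> ^ k) \<subseteq> A"
      "\<forall>\<^sub>F t in at s. h t \<in> B \<longrightarrow> cball (h t) (\<bar>t - s\<bar> ^ k) \<subseteq> B"
    unfolding eventually_sequentially by blast
  have lr: "\<forall>\<^sub>F t in at s. (t < s \<longrightarrow> h t \<in> A) \<and> (s < t \<longrightarrow> h t \<in> B)"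
    unfolding eventually_at_split
  proof
    show "\<forall>\<^sub>F t in at_left s. (t < s \<longrightarrow> h t \<in> A) \<and> (s < t \<longrightarrow> h t \<in> B)"
      using assms(7) unfolding eventually_at_filter by (auto elim: eventually_mono)
    show "\<forall>\<^sub>F t in at_right s. (t < s \<longrightarrow> h t \<in> A) \<and> (s < t \<longrightarrow> h t \<in> B)"
      using assms(8) unfolding eventually_at_filter by (auto elim: eventually_mono)
  qed
  have "\<forall>\<^sub>F t in at s. (t < s \<longrightarrow> cball (h t) (\<bar>t - s\<bar> ^ k) \<subseteq> A) \<and>
      (s < t \<longrightarrow> cball (h t) (\<bar>t - s\<bar> ^ k) \<subseteq> B)"
    using lr k(2,3) by eventually_elim auto
  then obtain d where "d > 0" and dd: "\<And>t. t \<noteq> s \<Longrightarrow> \<bar>t - s\<bar> < d \<Longrightarrow>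
      (t < s \<longrightarrow> cball (h t) (\<bar>t - s\<bar> ^ k) \<subseteq> A) \<and> (s < t \<longrightarrow> cball (h t) (\<bar>t - s\<bar> ^ k) \<subseteq> B)"
    unfolding eventually_at dist_real_def by blast
  have d: "d > 0"
    "\<And>t. t < s \<Longrightarrow> \<bar>t - s\<bar> < d \<Longrightarrow> cball (h t) (\<bar>t - s\<bar> ^ k) \<subseteq> A"
    "\<And>t. s < t \<Longrightarrow> \<bar>t - s\<bar> < d \<Longrightarrow> cball (h t) (\<bar>t - s\<bar> ^ k) \<subseteq> B"
    using \<open>d > 0\<close> dd by auto
  obtain r a where ra: "r > 0" "\<And>t. t \<in> ball s r \<Longrightarrow> (\<lambda>k. (t - s) ^ k *\<^sub>R a k) sums h t"
    using assms(1,2) unfolding real_analytic_on_def by blast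
  obtain M \<eta> where M: "M > 0" "\<eta> > 0" "\<And>t. \<bar>t - s\<bar> \<le> \<eta> \<Longrightarrow>
      norm (h t - (\<Sum>i<Suc k. (t - s) ^ i *\<^sub>R a i)) \<le> M * \<bar>t - s\<bar> ^ Suc k"
    using power_series_remainder[OF ra] by metis
  define \<delta> where "\<delta> = min (min (d / 2) \<eta>) (1 / (2 * M))"
  have \<delta>: "\<delta> > 0" "\<delta> < d" "\<delta> \<le> \<eta>" "\<delta> \<le> 1 / (2 * M)"
    using d(1) M(1,2) by (auto simp: \<delta>_def)
  have \<delta>M: "\<delta> * M \<le> 1 / 2"
    using mult_right_mono[OF \<delta>(4), of M] M(1) by simp
  define q where "q = (\<lambda>t. \<Sum>i<Suc k. (\<delta> * t) ^ i *\<^sub>R a i)"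
  have q: "polynomial_function q"
    unfolding q_def by (intro polynomial_function_intros) auto
  define Q where "Q = (\<lambda>z :: 'a \<times> real. q (snd z))"
  have Q: "polynomial_function Q"
    unfolding Q_def by (rule polynomial_function_comp[OF q polynomial_function_snd])
  have half: "cball (q t) (\<delta> ^ k / 2 * \<bar>t\<bar> ^ k) \<subseteq> cball (h (s + \<delta> * t)) (\<bar>s + \<delta> * t - s\<bar> ^ k)"
    if "\<bar>t\<bar> \<le> 1" for t
  proof -
    have t: "\<bar>\<delta> * t\<bar> \<le> \<delta>" using that \<delta>(1) by (simp add: abs_mult mult_left_le)
    have "dist (h (s + \<delta> * t)) (q t) \<le> M * \<bar>\<delta> * t\<bar> ^ Suc k"
      using M(3)[of "s + \<delta> * t"] t \<delta>(3) by (simp add: dist_norm q_def del: sum.lessThan_Suc)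
    also have "\<dots> = (M * \<bar>\<delta> * t\<bar>) * \<bar>\<delta> * t\<bar> ^ k" by simp
    also have "\<dots> \<le> (1 / 2) * \<bar>\<delta> * t\<bar> ^ k"
    proof (intro mult_right_mono)
      have "M * \<bar>\<delta> * t\<bar> \<le> M * \<delta>" using t M(1) by (intro mult_left_mono) auto
      then show "M * \<bar>\<delta> * t\<bar> \<le> 1 / 2" using \<delta>M by (simp add: mult.commute)
    qed auto
    finally have "dist (q t) (h (s + \<delta> * t)) \<le> (1 / 2) * \<bar>\<delta> * t\<bar> ^ k"
      by (simp add: dist_commute)
    moreover have "\<delta> ^ k / 2 * \<bar>t\<bar> ^ k = (1 / 2) * \<bar>\<delta> * t\<bar> ^ k"
      using \<delta>(1) by (simp add: abs_mult power_mult_distrib)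
    ultimately show ?thesis
      by (intro cball_subset_cball_iff[THEN iffD2] disjI1) (simp add: algebra_simps)
  qed
  have left: "cball (q (- t)) (\<delta> ^ k / 2 * t ^ k) \<subseteq> A" if t: "0 < t" "t \<le> 1" for t
  proof -
    have "\<delta> * t < d" using mult_left_le[of t \<delta>] t \<delta>(1,2) by linarith
    then have "cball (h (s + \<delta> * - t)) (\<bar>s + \<delta> * - t - s\<bar> ^ k) \<subseteq> A"
      using t \<delta>(1,2) by (intro d(2)) (auto simp: abs_mult)
    then show ?thesis
      using half[of "- t"] t by simp
  qed
  have right: "cball (q t) (\<delta> ^ k / 2 * t ^ k) \<subseteq> B" if t: "0 < t" "t \<le> 1" for t
  proof -
    have "\<delta> * t < d" using mult_left_le[of t \<delta>] t \<delta>(1,2) by linarith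
    then have "cball (h (s + \<delta> * t)) (\<bar>s + \<delta> * t - s\<bar> ^ k) \<subseteq> B"
      using t \<delta>(1,2) by (intro d(3)) (auto simp: abs_mult)
    then show ?thesis
      using half[of t] t by simp
  qed
  \<comment> \<open>At time \<open>0\<close> the margin is \<open>0\<close>, and membership follows since both sets are closed.\<close>
  have centre: "cball (q 0) (\<delta> ^ k / 2 * 0 ^ k) = {q 0}"
    using k(1) by (simp add: zero_power)
  have cont: "(q \<longlongrightarrow> q 0) (at 0 within T)" for T
    using continuous_polymonial_function[OF q, of 0]
    by (simp add: continuous_within tendsto_within_subset[of _ _ _ UNIV] isCont_def tendsto_mono[OF at_le])
  have "q 0 \<in> B"
  proof (rule Lim_in_closed_set[OF assms(4) _ _ cont[of "{0<..}"]])
    have "q t \<in> B" if "0 < t" "t \<le> 1" for t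
      using right[OF that] \<delta>(1) that by (auto simp: subset_iff)
    then show "\<forall>\<^sub>F t in at_right 0. q t \<in> B"
      unfolding eventually_at_right_field by (intro exI[of _ 1]) auto
  qed simp
  have "q 0 \<in> A"
  proof (rule Lim_in_closed_set[OF assms(3) _ _ cont[of "{..<0}"]])
    have "q t \<in> A" if "t < 0" "- 1 \<le> t" for t
      using left[of "- t"] \<delta>(1) that by (auto simp: subset_iff)
    then show "\<forall>\<^sub>F t in at_left 0. q t \<in> A"
      unfolding eventually_at_left_field by (intro exI[of _ "- 1"]) auto
  qed simp
  have "cball (Q (x, - t)) (\<delta> ^ k / 2 * t ^ k) \<subseteq> A \<and> cball (Q (x, t)) (\<delta> ^ k / 2 * t ^ k) \<subseteq> B"
    if "t \<in> {0..1}" for x t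
    using left[of t] right[of t] centre \<open>q 0 \<in> A\<close> \<open>q 0 \<in> B\<close> that unfolding Q_def
    by (cases "t = 0") (auto simp del: mem_cball)
  then show ?thesis
    unfolding passage_def using Q \<delta>(1) by (intro exI[of _ Q] conjI exI[of _ "\<delta> ^ k / 2"] exI[of _ k]) auto
qed

lemma open_avoids_hyperplanes:
  fixes W :: "'a::euclidean_space set"
  assumes "finite H" "\<And>v b. (v, b) \<in> H \<Longrightarrow> v \<noteq> 0" "open W" "W \<noteq> {}"
  shows "\<exists>x\<in>W. \<forall>(v, b)\<in>H. v \<bullet> x \<noteq> b"
  using assms
proof (induction H arbitrary: W rule: finite_induct)
  case (insert f H)
  obtain v b where f: "f = (v, b)" by force
  have "v \<noteq> 0" using insert.prems(1) f by blast
  define W' where "W' = W - {x. v \<bullet> x = b}"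
  have "open W'"
    unfolding W'_def using insert.prems(2) closed_hyperplane by (rule open_Diff)
  moreover have "W' \<noteq> {}"
  proof
    assume "W' = {}"
    then have "W \<subseteq> interior {x. v \<bullet> x = b}"
      unfolding W'_def using insert.prems(2) by (intro interior_maximal) auto
    then show False
      using interior_hyperplane[OF \<open>v \<noteq> 0\<close>, of b] insert.prems(3) by simp
  qed
  ultimately obtain x where "x \<in> W'" "\<forall>(v, b)\<in>H. v \<bullet> x \<noteq> b"
    using insert.IH[of W'] insert.prems(1) by blast
  then show ?case
    unfolding W'_def f by auto
qed auto

lemma strict_inequalities_imp_interior:
  fixes L :: "('a::euclidean_space \<times> real) set"
  assumes "finite L" "\<And>v b. (v, b) \<in> L \<Longrightarrow> v \<bullet> x < b"
  shows "x \<in> interior {x. \<forall>(v, b)\<in>L. v \<bullet> x \<le> b}"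
proof (rule interiorI)
  show "open (\<Inter>f\<in>L. {x. fst f \<bullet> x < snd f})"
    using assms(1) by (intro open_INT ballI open_halfspace_lt) auto
qed (use assms(2) in \<open>fastforce intro: less_imp_le\<close>)+

text \<open>
  A path that starts off finitely many hyperplanes meets them at isolated times and to finite order.
\<close>

lemma real_analytic_path_misses_hyperplanes:
  fixes h :: "real \<Rightarrow> 'a::euclidean_space"
  assumes "finite H" "h real_analytic_on U" "{0..1} \<subseteq> U" "\<And>v b. (v, b) \<in> H \<Longrightarrow> v \<bullet> h 0 \<noteq> b"
    and "s \<in> {0..1}"
  shows "\<And>v b. (v, b) \<in> H \<Longrightarrow> \<forall>\<^sub>F k in sequentially. \<forall>\<^sub>F t in at s. \<bar>t - s\<bar> ^ k \<le> \<bar>b - v \<bullet> h t\<bar>"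
    and "\<forall>\<^sub>F t in at s. \<forall>(v, b)\<in>H. v \<bullet> h t \<noteq> b"
proof -
  show order: "\<forall>\<^sub>F k in sequentially. \<forall>\<^sub>F t in at s. \<bar>t - s\<bar> ^ k \<le> \<bar>b - v \<bullet> h t\<bar>"
    if "(v, b) \<in> H" for v b
    using assms(4)[OF that] assms(3,5)
    by (intro real_analytic_finite_order[OF real_analytic_on_affine_form[OF assms(2)], where I = "{0..1}" and p = 0]) auto
  have "\<forall>\<^sub>F t in at s. v \<bullet> h t \<noteq> b" if vb: "(v, b) \<in> H" for v b
  proof -
    obtain k where "\<forall>\<^sub>F t in at s. \<bar>t - s\<bar> ^ k \<le> \<bar>b - v \<bullet> h t\<bar>"
      using order[OF vb] unfolding eventually_sequentially by blast
    moreover have "\<forall>\<^sub>F t in at s. t \<noteq> s"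
      by (rule eventually_neq_at_within)
    ultimately show ?thesis
    proof eventually_elim
      case (elim t)
      have "0 < \<bar>t - s\<bar> ^ k" using elim(2) by simp
      with elim(1) have "0 < \<bar>b - v \<bullet> h t\<bar>" by linarith
      then show ?case by auto
    qed
  qed
  then show "\<forall>\<^sub>F t in at s. \<forall>(v, b)\<in>H. v \<bullet> h t \<noteq> b"
    using assms(1) by (intro eventually_ball_finite) auto
qed

text \<open>
  Take an analytic path in the union from a point of \<open>A\<close> to a point of \<open>B\<close>, both outside all the
  hyperplanes that bound the polyhedra. Such a path meets the hyperplanes at isolated times
  only. Between two such times it cannot leave a polyhedron that contains it, and all polyhedra that
  contain it share interior points; at such a time it gives a passage from each polyhedron before to
  each polyhedron after. As \<open>{0..1}\<close> is connected, these local links join \<open>A\<close> to \<open>B\<close>. The starting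
  point has to be generic: a path inside a hyperplane could join polyhedra that no path through
  interior points can join.
\<close>

lemma polyhedra_linked_by_passages:
  fixes V :: "'b::euclidean_space set set" and X :: "'a::euclidean_space set"
  assumes "finite V" and V: "\<And>A. A \<in> V \<Longrightarrow> polyhedron A \<and> interior A \<noteq> {}"
    and conn: "connected_by_analytic_paths (\<Union>V)" and AB: "A \<in> V" "B \<in> V"
  shows "(\<lambda>A B. \<exists>Q. A \<in> V \<and> B \<in> V \<and> passage X A Q B)\<^sup>*\<^sup>* A B"
proof -
  define rel where "rel = (\<lambda>A B. \<exists>Q. A \<in> V \<and> B \<in> V \<and> passage X A Q B)\<^sup>*\<^sup>*"
  have "\<forall>A\<in>V. \<exists>L. finite L \<and> (\<forall>(v, b)\<in>L. v \<noteq> 0) \<and> A = {x. \<forall>(v, b)\<in>L. v \<bullet> x \<le> b}"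
  proof
    fix A assume "A \<in> V"
    with V have "polyhedron A" by blast
    then obtain L where "finite L" "\<And>v b. (v, b) \<in> L \<Longrightarrow> v \<noteq> 0" "A = {x. \<forall>(v, b)\<in>L. v \<bullet> x \<le> b}"
      by (rule polyhedron_as_inequalities) blast
    then show "\<exists>L. finite L \<and> (\<forall>(v, b)\<in>L. v \<noteq> 0) \<and> A = {x. \<forall>(v, b)\<in>L. v \<bullet> x \<le> b}"
      by (intro exI[of _ L] conjI) auto
  qed
  then obtain L where L0: "\<forall>A\<in>V. finite (L A) \<and> (\<forall>(v, b)\<in>L A. v \<noteq> 0) \<and> A = {x. \<forall>(v, b)\<in>L A. v \<bullet> x \<le> b}"
    by (rule bchoice[THEN exE])
  have L: "finite (L A)" "(v, b) \<in> L A \<Longrightarrow> v \<noteq> 0" "A = {x. \<forall>(v, b)\<in>L A. v \<bullet> x \<le> b}"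
    if "A \<in> V" for A v b
    using bspec[OF L0 that] by blast+
  have in_cell: "x \<in> A \<longleftrightarrow> (\<forall>(v, b)\<in>L A. v \<bullet> x \<le> b)" if "A \<in> V" for A x
    by (subst L(3)[OF that]) simp
  define H where "H = (\<Union>A\<in>V. L A)"
  have H: "finite H" "\<And>v b. (v, b) \<in> H \<Longrightarrow> v \<noteq> 0"
    using assms(1) L(1,2) by (auto simp: H_def)
  define generic where "generic = (\<lambda>x. \<forall>(v, b)\<in>H. v \<bullet> x \<noteq> b)"
  have interior: "x \<in> interior C" if "generic x" "C \<in> V" "x \<in> C" for x C
  proof -
    have "v \<bullet> x < b" if vb: "(v, b) \<in> L C" for v b
    proof -
      have "v \<bullet> x \<le> b" using in_cell[OF \<open>C \<in> V\<close>] \<open>x \<in> C\<close> vb by blast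
      moreover have "v \<bullet> x \<noteq> b"
        using \<open>generic x\<close> vb \<open>C \<in> V\<close> unfolding generic_def H_def by blast
      ultimately show ?thesis by simp
    qed
    then show ?thesis
      using strict_inequalities_imp_interior[OF L(1)[OF \<open>C \<in> V\<close>]] L(3)[OF \<open>C \<in> V\<close>, symmetric] by simp
  qed
  have same: "rel C C'" if "generic x" "C \<in> V" "C' \<in> V" "x \<in> C" "x \<in> C'" for x C C'
  proof -
    have "passage X C (\<lambda>_. x) C'"
      using that by (intro passage_through_common_interior interior)
    then show ?thesis
      using that unfolding rel_def by (intro r_into_rtranclp) blast
  qed
  have generic_in: "\<exists>x\<in>C. generic x" if "C \<in> V" for C
    using open_avoids_hyperplanes[OF H(1) _ open_interior[of C]] H(2) V[OF that] interior_subset[of C]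
    unfolding generic_def by blast
  obtain p q where pq: "p \<in> A" "generic p" "q \<in> B" "generic q"
    using generic_in AB by blast
  then have "p \<in> \<Union>V" "q \<in> \<Union>V" using AB by auto
  then obtain g where g: "analytic_path g" "path_image g \<subseteq> \<Union>V" "pathstart g = p" "pathfinish g = q"
    using conn unfolding connected_by_analytic_paths_def by blast
  then obtain U h where Uh: "{0..1} \<subseteq> U" "h real_analytic_on U" "\<And>t. t \<in> {0..1} \<Longrightarrow> h t = g t"
    unfolding analytic_path_def by blast
  have h: "\<exists>C\<in>V. h t \<in> C" if "t \<in> {0..1}" for t
    using g(2) Uh(3)[OF that] that unfolding path_image_def by blast
  have h01: "h 0 = p" "h 1 = q"
    using g(3,4) Uh(3) by (auto simp: pathstart_def pathfinish_def)
  have "generic (h 0)" using h01 pq(2) by simp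
  then have h0: "v \<bullet> h 0 \<noteq> b" if "(v, b) \<in> H" for v b
    using that unfolding generic_def by blast
  have order: "\<forall>\<^sub>F k in sequentially. \<forall>\<^sub>F t in at s. \<bar>t - s\<bar> ^ k \<le> \<bar>b - v \<bullet> h t\<bar>"
    if "s \<in> {0..1}" "(v, b) \<in> H" for s v b
    by (rule real_analytic_path_misses_hyperplanes(1)[OF H(1) Uh(2,1) _ that]) (rule h0)
  have generic_near: "\<forall>\<^sub>F t in at s. generic (h t)" if "s \<in> {0..1}" for s
    using real_analytic_path_misses_hyperplanes(2)[OF H(1) Uh(2,1) h0 that] unfolding generic_def by blast
  have cont: "continuous_on {0..1} h"
    using real_analytic_on_isCont[OF Uh(2)] Uh(1) by (intro continuous_at_imp_continuous_on) auto
  have stay: "h t' \<in> C" if J: "connected J" "J \<subseteq> {0..1}" "\<And>t. t \<in> J \<Longrightarrow> generic (h t)"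
    and t: "t \<in> J" "t' \<in> J" "C \<in> V" "h t \<in> C" for J t t' C
  proof -
    have "v \<bullet> h t' \<le> b" if vb: "(v, b) \<in> L C" for v b
    proof (rule ccontr)
      assume "\<not> v \<bullet> h t' \<le> b"
      moreover have "v \<bullet> h t \<le> b" using in_cell[OF t(3)] t(4) vb by blast
      moreover have "connected (h ` J)"
        using J(1,2) cont by (intro connected_continuous_image continuous_on_subset[OF cont])
      ultimately obtain z where "z \<in> h ` J" "v \<bullet> z = b"
        using connected_ivt_hyperplane[of "h ` J" "h t" "h t'" v b] t(1,2) by auto
      then show False
        using J(3) vb t(3) unfolding generic_def H_def by blast
    qed
    then show ?thesis using in_cell[OF t(3)] by blast
  qed
  define R where "R = (\<lambda>t t'. t \<in> {0..1} \<and> t' \<in> {0..1} \<and>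
      (\<forall>C\<in>V. \<forall>C'\<in>V. h t \<in> C \<longrightarrow> h t' \<in> C' \<longrightarrow> rel C C'))"
  have R_rel: "rel C C'" if "R t t'" "C \<in> V" "C' \<in> V" "h t \<in> C" "h t' \<in> C'" for t t' C C'
    using that by (simp add: R_def)
  have interval: "R t t'" if "connected J" "J \<subseteq> {0..1}" "\<And>t. t \<in> J \<Longrightarrow> generic (h t)" "t \<in> J" "t' \<in> J" for J t t'
    unfolding R_def
  proof (intro conjI ballI impI)
    fix C C' assume C: "C \<in> V" "C' \<in> V" "h t \<in> C" "h t' \<in> C'"
    have "h t' \<in> C"
      by (rule stay[of J]) (use that C in auto)
    then show "rel C C'"
      using that(3)[OF that(5)] C by (intro same[of "h t'"])
  qed (use that in auto)
  have trans: "R x z" if xy: "R x y" and yz: "R y z" for x y z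
    unfolding R_def
  proof (intro conjI ballI impI)
    fix C C' assume C: "C \<in> V" "C' \<in> V" "h x \<in> C" "h z \<in> C'"
    have "y \<in> {0..1}" using xy by (simp add: R_def)
    then obtain D where D: "D \<in> V" "h y \<in> D" using h[of y] by blast
    have "rel C D" by (rule R_rel[OF xy C(1) D(1) C(3) D(2)])
    moreover have "rel D C'" by (rule R_rel[OF yz D(1) C(2) D(2) C(4)])
    ultimately show "rel C C'" unfolding rel_def by (rule rtranclp_trans)
  qed (use xy yz in \<open>simp_all add: R_def\<close>)
  have dense: "\<exists>z. z \<in> T \<and> generic (h z)" if T: "openin (top_of_set {0..1}) T" "a \<in> T" for T a
  proof -
    have a: "a \<in> {0..1}" using T openin_imp_subset by blast
    have "\<forall>\<^sub>F t in at a within {0..1}. t \<in> T"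
      using T unfolding openin_open eventually_at_topological by blast
    moreover have "\<forall>\<^sub>F t in at a within {0..1}. generic (h t)"
      by (rule filter_leD[OF at_le[OF subset_UNIV] generic_near[OF a]])
    ultimately have "\<forall>\<^sub>F t in at a within {0..1}. t \<in> T \<and> generic (h t)"
      by eventually_elim simp
    moreover have "at a within {0..1} \<noteq> bot"
      using a by (simp add: trivial_limit_within islimpt_Icc)
    ultimately show ?thesis
      using eventually_happens'[of "at a within {0..1}"] by blast
  qed
  have local: "\<exists>T. openin (top_of_set {0..1}) T \<and> s \<in> T \<and>
      (\<forall>x\<in>T. \<forall>y\<in>T. generic (h x) \<and> generic (h y) \<longrightarrow> R x y)" if s: "s \<in> {0..1}" for s
  proof -
    obtain d where d: "d > 0" "\<forall>t\<in>UNIV. t \<noteq> s \<and> dist t s < d \<longrightarrow> generic (h t)"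
      using generic_near[OF s, unfolded eventually_at] by (elim exE conjE) (rule that)
    define T where "T = {0..1} \<inter> {s - d<..<s + d}"
    have generic_T: "generic (h t)" if "t \<in> T" "t \<noteq> s" for t
    proof -
      have "dist t s < d" using that(1) by (auto simp: T_def dist_real_def)
      with that(2) d(2) show ?thesis by simp
    qed
    have opposite: "R x y \<and> R y x" if xy: "x \<in> T" "y \<in> T" "x < s" "s < y" for x y
    proof -
      have "rel C C' \<and> rel C' C" if C: "C \<in> V" "C' \<in> V" "h x \<in> C" "h y \<in> C'" for C C'
      proof -
        have sub: "{x..<s} \<subseteq> T" "{s<..y} \<subseteq> T" "T \<subseteq> {0..1}"
          using xy by (auto simp: T_def)
        have "h t \<in> C" if "t \<in> {x..<s}" for t
          proof (rule stay[of "{x..<s}" x])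
          show "{x..<s} \<subseteq> {0..1}" using sub(1,3) by blast
          show "generic (h t)" if "t \<in> {x..<s}" for t
            using that sub(1) by (intro generic_T) auto
        qed (use that xy C in auto)
        then have left: "\<forall>\<^sub>F t in at_left s. h t \<in> C"
          unfolding eventually_at_left_field using xy(3) by (intro exI[of _ x]) auto
        have "h t \<in> C'" if "t \<in> {s<..y}" for t
          proof (rule stay[of "{s<..y}" y])
          show "{s<..y} \<subseteq> {0..1}" using sub(2,3) by blast
          show "generic (h t)" if "t \<in> {s<..y}" for t
            using that sub(2) by (intro generic_T) auto
        qed (use that xy C in auto)
        then have right: "\<forall>\<^sub>F t in at_right s. h t \<in> C'"
          unfolding eventually_at_right_field using xy(4) by (intro exI[of _ y]) auto
        have margin: "\<forall>\<^sub>F k in sequentially. \<forall>\<^sub>F t in at s. h t \<in> D \<longrightarrow> cball (h t) (\<bar>t - s\<bar> ^ k) \<subseteq> D"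
          if "D \<in> V" for D
          by (rule polyhedron_margin[OF L(1)[OF that] L(3)[OF that]], rule order[OF s])
            (use that in \<open>auto simp: H_def\<close>)
        have "closed C" "closed C'" using V C polyhedron_imp_closed by auto
        then obtain Q where Q: "passage X C Q C'"
          using passage_along_analytic_path[OF Uh(2) _ _ _ margin[OF C(1)] margin[OF C(2)] left right, where X = X]
            s Uh(1) by blast
        then have "passage X C' (\<lambda>z. Q (fst z, - snd z)) C"
          by (rule passage_reverse)
        with Q show ?thesis
          using C unfolding rel_def by (intro conjI r_into_rtranclp) blast+
      qed
      then show ?thesis
        using xy unfolding R_def T_def by auto
    qed
    have "R x y" if xy: "x \<in> T" "y \<in> T" "generic (h x)" "generic (h y)" for x y
    proof (cases "x < s \<and> s < y \<or> y < s \<and> s < x")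
      case True
      then show ?thesis using opposite xy by blast
    next
      case False
      define J where "J = {min x y..max x y}"
      have "generic (h t)" if "t \<in> J" for t
      proof (cases "t = s")
        case True
        then have "s = x \<or> s = y"
          using that False by (auto simp: J_def min_def max_def split: if_splits)
        then show ?thesis using xy True by auto
      next
        case False
        then show ?thesis
          using that xy by (intro generic_T) (auto simp: J_def T_def min_def max_def split: if_splits)
      qed
      then show ?thesis
        using xy by (intro interval[of J]) (auto simp: J_def T_def min_def max_def split: if_splits)
    qed
    moreover have "openin (top_of_set {0..1}) T" "s \<in> T"
      using s d(1) unfolding T_def by (simp_all add: openin_open_Int)
    ultimately show ?thesis by blast
  qed
  have "0 \<in> {0..1::real}" "1 \<in> {0..1::real}" "generic (h 0)" "generic (h 1)"
    using h01 pq by auto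
  then have "R 0 1"
    by (rule connected_equivalence_relation_gen[where P = "\<lambda>t. generic (h t)", OF connected_Icc _ _ _ _ trans dense local])
  then have "rel A B"
    using AB pq(1,3) h01 by (intro R_rel) auto
  then show ?thesis
    unfolding rel_def .
qed

section \<open>Balls, cubes and simplices\<close>

text \<open>
  The logistic map sends \<open>{0..a}\<close> onto a set that contains \<open>{0..2 * a}\<close> if \<open>a \<le> 1/2\<close>, as
  \<open>4 * a * (1 - a) \<ge> 2 * a\<close>. So its iterates stretch a tiny interval over all of \<open>{0..1}\<close>, and they
  never leave \<open>{0..1}\<close>.
\<close>

lemma logistic_iterate_onto:
  fixes w :: real
  assumes "w \<in> {0..1}"
  shows "\<exists>v\<in>{0..(1/2) ^ r}. ((\<lambda>v. 4 * v * (1 - v)) ^^ r) v = w"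
proof (induction r)
  case (Suc r)
  then obtain u where u: "u \<in> {0..(1/2) ^ r}" "((\<lambda>v. 4 * v * (1 - v)) ^^ r) u = w"
    by blast
  define a :: real where "a = (1/2) ^ Suc r"
  have a: "0 \<le> a" "a \<le> 1/2" "(1/2) ^ r = 2 * a"
    by (auto simp: a_def power_le_one)
  have "u \<le> 2 * a" using u(1) a(3) by simp
  also have "\<dots> \<le> 4 * a * (1 - a)"
    using mult_left_mono[of "1/2" "1 - a" "4 * a"] a(1,2) by simp
  finally have "\<exists>v. 0 \<le> v \<and> v \<le> a \<and> 4 * v * (1 - v) = u"
    using u(1) a(1) by (intro IVT') (auto intro!: continuous_intros)
  then obtain v where "v \<in> {0..a}" "4 * v * (1 - v) = u"
    by auto
  then show ?case
    using u(2) unfolding a_def[symmetric] by (intro bexI[of _ v]) (simp_all del: funpow.simps add: funpow_Suc_right)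
qed (use assms in auto)

lemma logistic_iterate_range:
  fixes v :: real
  assumes "v \<in> {0..1}"
  shows "((\<lambda>v. 4 * v * (1 - v)) ^^ r) v \<in> {0..1}"
proof (induction r)
  case (Suc r)
  define u where "u = ((\<lambda>v. 4 * v * (1 - v)) ^^ r) v"
  have u: "0 \<le> u" "u \<le> 1" using Suc by (auto simp: u_def)
  have "4 * u * (1 - u) = 1 - (1 - 2 * u)\<^sup>2"
    by (simp add: power2_eq_square algebra_simps)
  then have "4 * u * (1 - u) \<le> 1" by simp
  moreover have "0 \<le> 4 * u * (1 - u)" using u by simp
  ultimately show ?case by (simp add: u_def)
qed (use assms in simp)

lemma polynomial_function_logistic_iterate:
  fixes p :: "'a::real_normed_vector \<Rightarrow> real"
  shows "polynomial_function p \<Longrightarrow> polynomial_function (\<lambda>x. ((\<lambda>v. 4 * v * (1 - v)) ^^ r) (p x))"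
proof (induction r)
  case (Suc r)
  then show ?case
    unfolding funpow.simps o_def
    by (intro polynomial_function_intros)
qed simp

lemma polynomial_function_vec:
  fixes f :: "'a::real_normed_vector \<Rightarrow> real ^ 'm"
  assumes "\<And>i. polynomial_function (\<lambda>x. f x $ i)"
  shows "polynomial_function f"
  unfolding polynomial_function_iff_Basis_inner
  using assms by (auto simp: Basis_vec_def inner_axis real_polynomial_function_eq)

text \<open>
  Coordinatewise, \<open>y \<mapsto> y\<^sup>2\<close> is followed by an iterate of the logistic map that covers \<open>{0..1}\<close> already
  on \<open>{0..1 / CARD('m)}\<close>. The points of the ball whose squared coordinates are that small suffice to
  reach every point of the cube.
\<close>

lemma polynomial_image_ball_eq_cube:
  obtains \<psi> :: "real ^ 'm \<Rightarrow> real ^ 'm" where "polynomial_function \<psi>" "\<psi> ` cball 0 1 = cbox 0 1"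
proof -
  obtain r where r: "(1/2::real) ^ r < 1 / real CARD('m)"
    using real_arch_pow_inv[of "1 / real CARD('m)" "1/2"] by auto
  define g :: "real \<Rightarrow> real" where "g = (\<lambda>y. ((\<lambda>v. 4 * v * (1 - v)) ^^ r) (y\<^sup>2))"
  define \<psi> :: "real ^ 'm \<Rightarrow> real ^ 'm" where "\<psi> = (\<lambda>z. \<chi> i. g (z $ i))"
  show ?thesis
  proof
    show "polynomial_function \<psi>"
    proof (rule polynomial_function_vec)
      show "polynomial_function (\<lambda>x. \<psi> x $ i)" for i
        unfolding \<psi>_def g_def vec_lambda_beta
        by (intro polynomial_function_logistic_iterate polynomial_function_power_real polynomial_function_vec_nth)
    qed
    have "\<psi> z \<in> cbox 0 1" if "z \<in> cball 0 1" for z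
    proof -
      have "g (z $ i) \<in> {0..1}" for i
      proof -
        have "\<bar>z $ i\<bar> \<le> 1"
          using component_le_norm_cart[of z i] that by simp
        then show ?thesis
          unfolding g_def by (intro logistic_iterate_range) (simp add: abs_square_le_1)
      qed
      then show ?thesis
        by (auto simp: mem_box_cart \<psi>_def)
    qed
    moreover have "x \<in> \<psi> ` cball 0 1" if "x \<in> cbox 0 1" for x
    proof -
      have "\<exists>v\<in>{0..(1/2) ^ r}. ((\<lambda>v. 4 * v * (1 - v)) ^^ r) v = x $ i" for i
        using that by (intro logistic_iterate_onto) (auto simp: mem_box_cart)
      then obtain v where v: "\<And>i. v i \<in> {0..(1/2) ^ r}" "\<And>i. ((\<lambda>v. 4 * v * (1 - v)) ^^ r) (v i) = x $ i"
        by metis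
      define z :: "real ^ 'm" where "z = (\<chi> i. sqrt (v i))"
      have "z \<bullet> z = (\<Sum>i\<in>UNIV. v i)"
        using v(1) by (simp add: inner_vec_def z_def)
      also have "\<dots> \<le> (\<Sum>i\<in>(UNIV :: 'm set). (1/2) ^ r)"
        using v(1) by (intro sum_mono) simp
      also have "\<dots> \<le> 1"
        using r by (simp add: field_simps)
      finally have "z \<in> cball 0 1"
        by (simp add: norm_eq_sqrt_inner)
      moreover have "\<psi> z = x"
        using v by (simp add: \<psi>_def g_def z_def vec_eq_iff)
      ultimately show ?thesis by blast
    qed
    ultimately show "\<psi> ` cball 0 1 = cbox 0 1" by blast
  qed
qed

text \<open>
  The cone over a convex hull with apex \<open>v i\<close> is swept out by the segments to the apex, with one new
  coordinate as the parameter. The parameter has to be independent of the coordinates in use, which is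
  why the induction records that \<open>\<sigma>\<close> depends on the coordinates in \<open>I\<close> only.
\<close>

lemma polynomial_image_cube_eq_convex_hull:
  fixes v :: "'m::finite \<Rightarrow> 'b::euclidean_space"
  shows "\<exists>\<sigma> :: real ^ 'm \<Rightarrow> 'b. polynomial_function \<sigma> \<and> (\<forall>x y. (\<forall>i\<in>I. x $ i = y $ i) \<longrightarrow> \<sigma> x = \<sigma> y) \<and>
     \<sigma> ` cbox 0 1 = convex hull (insert w (v ` I))"
proof -
  have "finite I" by simp
  then show ?thesis
  proof (induction I rule: finite_induct)
    case empty
    have "cbox 0 1 \<noteq> ({} :: (real ^ 'm) set)"
      by (simp add: interval_ne_empty_cart)
    then show ?case
      by (intro exI[of _ "\<lambda>_. w"]) auto
  next
    case (insert i I)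
    then obtain \<sigma> :: "real ^ 'm \<Rightarrow> 'b" where \<sigma>: "polynomial_function \<sigma>"
      "\<And>x y. (\<And>i. i \<in> I \<Longrightarrow> x $ i = y $ i) \<Longrightarrow> \<sigma> x = \<sigma> y"
      "\<sigma> ` cbox 0 1 = convex hull (insert w (v ` I))"
      by metis
    define \<tau> where "\<tau> = (\<lambda>x. (1 - x $ i) *\<^sub>R \<sigma> x + (x $ i) *\<^sub>R v i)"
    have hull: "convex hull (insert w (v ` insert i I)) = {y. \<exists>u\<ge>0. \<exists>u'\<ge>0. \<exists>b.
        u + u' = 1 \<and> b \<in> \<sigma> ` cbox 0 1 \<and> y = u *\<^sub>R v i + u' *\<^sub>R b}"
      unfolding \<sigma>(3) image_insert insert_commute[of w] by (rule convex_hull_insert) simp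
    have "\<tau> x \<in> convex hull (insert w (v ` insert i I))" if "x \<in> cbox 0 1" for x
      unfolding hull mem_Collect_eq using that
      by (intro exI[of _ "x $ i"] exI[of _ "1 - x $ i"] exI[of _ "\<sigma> x"] conjI)
        (auto simp: \<tau>_def mem_box_cart)
    moreover have "y \<in> \<tau> ` cbox 0 1" if y_in: "y \<in> convex hull (insert w (v ` insert i I))" for y
    proof -
      obtain u u' b where ub: "u \<ge> 0" "u' \<ge> 0" "u + u' = 1" "b \<in> \<sigma> ` cbox 0 1" "y = u *\<^sub>R v i + u' *\<^sub>R b"
        using y_in unfolding hull mem_Collect_eq by (elim exE conjE) (rule that)
      then obtain x where y: "u \<ge> 0" "u' \<ge> 0" "x \<in> cbox 0 1" "u + u' = 1" "y = u *\<^sub>R v i + u' *\<^sub>R \<sigma> x"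
        by blast
      define x' where "x' = (\<chi> j. if j = i then u else x $ j)"
      have "x' \<in> cbox 0 1"
        using y(1-4) by (auto simp: mem_box_cart x'_def)
      moreover have "\<sigma> x' = \<sigma> x"
        using insert.hyps(2) by (intro \<sigma>(2)) (auto simp: x'_def)
      moreover have "x' $ i = u" "1 - u = u'"
        using y(4) by (auto simp: x'_def)
      ultimately show ?thesis
        using y(5) by (intro image_eqI[of _ _ x']) (auto simp: \<tau>_def)
    qed
    ultimately have "\<tau> ` cbox 0 1 = convex hull (insert w (v ` insert i I))"
      by blast
    moreover have "polynomial_function \<tau>"
      unfolding \<tau>_def by (intro polynomial_function_intros polynomial_function_vec_nth \<sigma>(1))
    moreover have "\<tau> x = \<tau> y" if "\<forall>j\<in>insert i I. x $ j = y $ j" for x y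
      using that \<sigma>(2)[of x y] by (simp add: \<tau>_def)
    ultimately show ?case by blast
  qed
qed

text \<open>
  Caratheodory's theorem with the points listed, possibly with repetitions, by an index type of
  the right size.
\<close>

lemma caratheodory_range:
  fixes x :: "'b::euclidean_space"
  assumes "x \<in> convex hull W" "CARD('m::finite) = DIM('b) + 1"
  obtains v :: "'m::finite \<Rightarrow> 'b" where "range v \<subseteq> W" "x \<in> convex hull (range v)"
proof -
  obtain S where S: "finite S" "S \<subseteq> W" "card S \<le> DIM('b) + 1" "x \<in> convex hull S"
    using assms(1) unfolding caratheodory[of W] by blast
  have "S \<noteq> {}" using S(4) by auto
  then obtain a where a: "a \<in> S" by blast
  have "card S \<le> card (UNIV :: 'm set)" using S(3) assms(2) by simp
  then obtain f :: "'b \<Rightarrow> 'm" where f: "inj_on f S"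
    using card_le_inj[OF S(1), of "UNIV :: 'm set"] by auto
  define v where "v = (\<lambda>j. if j \<in> f ` S then inv_into S f j else a)"
  have "v j \<in> S" for j
    using a by (auto simp: v_def inv_into_into)
  moreover have "s \<in> range v" if "s \<in> S" for s
    using f that by (intro image_eqI[of _ _ "f s"]) (auto simp: v_def)
  ultimately have "range v = S" by blast
  then show ?thesis using that[of v] S by simp
qed

section \<open>Unions of polyhedra as polynomial images of a ball\<close>

text \<open>
  One coordinate \<open>i0\<close> of the cube serves as time and the others parametrise simplices. By
  Caratheodory's theorem every polytope is the union of the convex hulls of families of \<open>DIM('b) + 1\<close>
  points from a finite set that spans it. For each of these finitely many families the map has a time \<open>j\<close> at which it covers
  the convex hull of the family, and at all times it stays in the union.
\<close>

lemma polynomial_image_of_ball: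
  fixes V :: "'b::euclidean_space set set"
  assumes "finite V" "V \<noteq> {}" and V: "\<And>A. A \<in> V \<Longrightarrow> polytope A \<and> interior A \<noteq> {}"
    and conn: "connected_by_analytic_paths (\<Union>V)" and "CARD('m::finite) = DIM('b) + 1"
  shows "\<exists>f :: real ^ 'm \<Rightarrow> 'b. polynomial_function f \<and> f ` cball 0 1 = \<Union>V"
proof -
  define K :: "(real ^ 'm) set" where "K = cbox 0 1"
  obtain \<psi> :: "real ^ 'm \<Rightarrow> real ^ 'm" where \<psi>: "polynomial_function \<psi>" "\<psi> ` cball 0 1 = K"
    unfolding K_def by (rule polynomial_image_ball_eq_cube)
  define i0 :: 'm where "i0 = undefined"
  have "\<exists>\<sigma> :: real ^ 'm \<Rightarrow> 'b. polynomial_function \<sigma> \<and> (\<forall>x y. (\<forall>i\<in>UNIV - {i0}. x $ i = y $ i) \<longrightarrow> \<sigma> x = \<sigma> y) \<and>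
     \<sigma> ` K = convex hull (range v)" for v :: "'m \<Rightarrow> 'b"
  proof -
    have "range v = insert (v i0) (v ` (UNIV - {i0}))" by auto
    then show ?thesis
      unfolding K_def using polynomial_image_cube_eq_convex_hull[of "UNIV - {i0}" "v i0" v] by simp
  qed
  then obtain \<sigma> :: "('m \<Rightarrow> 'b) \<Rightarrow> real ^ 'm \<Rightarrow> 'b" where \<sigma>: "\<And>v. polynomial_function (\<sigma> v)"
    "\<And>v x y. (\<And>i. i \<noteq> i0 \<Longrightarrow> x $ i = y $ i) \<Longrightarrow> \<sigma> v x = \<sigma> v y" "\<And>v. \<sigma> v ` K = convex hull (range v)"
    by (metis DiffE singletonI)
  have "\<forall>A\<in>V. \<exists>W. finite W \<and> A = convex hull W"
    using V unfolding polytope_def by blast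
  then obtain W where W: "\<forall>A\<in>V. finite (W A) \<and> A = convex hull (W A)"
    by (rule bchoice[THEN exE])
  have "\<forall>A\<in>V. \<exists>p. p \<in> interior A"
    using V by blast
  then obtain p where p: "\<forall>A\<in>V. p A \<in> interior A"
    by (rule bchoice[THEN exE])
  define Q where "Q = (\<lambda>A v (z :: (real ^ 'm) \<times> real). (1 - (snd z)\<^sup>2) *\<^sub>R \<sigma> v (fst z) + (snd z)\<^sup>2 *\<^sub>R p A)"
  define T where "T = (\<Union>A\<in>V. (\<lambda>v. (A, Q A v)) ` {v. range v \<subseteq> W A})"
  have conv: "convex A" if "A \<in> V" for A
    using V[OF that] polytope_imp_convex by blast
  have hull_sub: "convex hull (range v) \<subseteq> A" if "A \<in> V" "range v \<subseteq> W A" for A and v :: "'m \<Rightarrow> 'b"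
    using hull_mono[OF that(2), of convex] W that(1) by metis
  have finT: "finite T"
  proof -
    have "{v :: 'm \<Rightarrow> 'b. range v \<subseteq> W A} = PiE UNIV (\<lambda>_. W A)" for A
      by (auto simp: PiE_UNIV_domain)
    then show ?thesis
      unfolding T_def using W assms(1) by (auto intro!: finite_PiE)
  qed
  have T_nonempty: "T \<noteq> {}"
  proof -
    obtain A where A: "A \<in> V" using assms(2) by blast
    have "W A \<noteq> {}"
    proof
      assume "W A = {}"
      then have "A = {}" using W A by (metis convex_hull_eq_empty)
      then show False using V[OF A] by simp
    qed
    then obtain a where "a \<in> W A" by blast
    then have "(A, Q A (\<lambda>_. a)) \<in> T"
      unfolding T_def using A by blast
    then show ?thesis by blast
  qed
  have stay: "A \<in> V \<and> passage K A Q' A" if "(A, Q') \<in> T" for A Q'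
  proof -
    obtain v where v: "A \<in> V" "range v \<subseteq> W A" "Q' = Q A v"
      using \<open>(A, Q') \<in> T\<close> unfolding T_def by blast
    have "p A \<in> interior A" using p v(1) by blast
    moreover have "\<sigma> v ` K \<subseteq> A" using hull_sub[OF v(1,2)] \<sigma>(3) by simp
    ultimately have "passage K A (Q A v) A"
      unfolding Q_def by (intro passage_through_subset conv v(1) \<sigma>(1))
    then show ?thesis using v by simp
  qed
  have linked: "(\<lambda>A B. \<exists>Q. A \<in> V \<and> B \<in> V \<and> passage K A Q B)\<^sup>*\<^sup>* A B" if "A \<in> V" "B \<in> V" for A B
  proof (rule polyhedra_linked_by_passages[OF assms(1) _ conn that])
    show "polyhedron A \<and> interior A \<noteq> {}" if "A \<in> V" for A
      using V[OF that] polytope_imp_polyhedron by blast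
  qed
  have "compact K" by (simp add: K_def)
  then obtain F N where F: "polynomial_function F" "F ` (K \<times> {0..real N}) \<subseteq> \<Union>V"
    "\<forall>(A, Q)\<in>T. \<exists>j\<le>N. \<forall>x\<in>K. F (x, real j) = Q (x, 0)"
    by (rule polynomial_map_visiting[OF _ finT T_nonempty conv stay linked])
  define f where "f = (\<lambda>z. F (\<psi> z, real N * (\<psi> z $ i0)))"
  have "polynomial_function (\<lambda>z. (\<psi> z, real N * (\<psi> z $ i0)))"
    by (intro polynomial_function_intros \<psi>(1) polynomial_function_comp[OF polynomial_function_vec_nth])
  then have "polynomial_function f"
    unfolding f_def by (rule polynomial_function_comp[OF F(1)])
  moreover have "f z \<in> \<Union>V" if "z \<in> cball 0 1" for z
  proof -
    have "\<psi> z \<in> K" using \<psi>(2) that by blast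
    moreover from this have "0 \<le> \<psi> z $ i0" "\<psi> z $ i0 \<le> 1"
      by (auto simp: K_def mem_box_cart)
    then have "real N * (\<psi> z $ i0) \<in> {0..real N}"
      by (auto simp: mult_left_le)
    ultimately show ?thesis
      using F(2) unfolding f_def by blast
  qed
  moreover have "y \<in> f ` cball 0 1" if "A \<in> V" "y \<in> A" for A y
  proof -
    have "y \<in> convex hull (W A)" using W that by blast
    then obtain v :: "'m \<Rightarrow> 'b" where v: "range v \<subseteq> W A" "y \<in> convex hull (range v)"
      using assms(5) by (rule caratheodory_range)
    obtain x0 where x0: "x0 \<in> K" "y = \<sigma> v x0"
      using v(2) unfolding \<sigma>(3)[symmetric] by blast
    have "(A, Q A v) \<in> T"
      unfolding T_def using that(1) v(1) by blast
    then obtain j where j: "j \<le> N" "\<forall>x\<in>K. F (x, real j) = Q A v (x, 0)"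
      using F(3) by blast
    \<comment> \<open>If \<open>N = 0\<close> then \<open>j = 0\<close>, and the convention \<open>0 / 0 = 0\<close> gives the right time.\<close>
    define x where "x = (\<chi> k. if k = i0 then real j / real N else x0 $ k)"
    have "x \<in> K"
      using x0(1) j(1) by (auto simp: K_def mem_box_cart x_def divide_le_eq)
    then obtain z where z: "z \<in> cball 0 1" "\<psi> z = x"
      using \<psi>(2) by blast
    have "real N * (x $ i0) = real j"
      using j(1) by (simp add: x_def)
    then have "f z = F (x, real j)"
      by (simp add: f_def z(2))
    also have "\<dots> = \<sigma> v x"
      using j(2) \<open>x \<in> K\<close> by (simp add: Q_def)
    also have "\<dots> = y"
      unfolding x0(2) by (rule \<sigma>(2)) (simp add: x_def)
    finally show ?thesis using z(1) by blast
  qed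
  ultimately show ?thesis by blast
qed

text \<open>
  The expansion at \<open>t\<close> is the polynomial \<open>s \<mapsto> p (s + t)\<close>, read off in coordinates.
\<close>

lemma polynomial_function_real_analytic:
  fixes p :: "real \<Rightarrow> 'a::euclidean_space"
  assumes "polynomial_function p"
  shows "p real_analytic_on U"
  unfolding real_analytic_on_def
proof
  fix t
  have shift: "polynomial_function (\<lambda>s. p (s + t))"
    by (rule polynomial_function_comp[OF assms]) (intro polynomial_function_intros)
  have "\<exists>a n. \<forall>s. p (s + t) \<bullet> b = (\<Sum>i\<le>n. a i * s ^ i)" if "b \<in> Basis" for b
  proof -
    have "real_polynomial_function (\<lambda>s. p (s + t) \<bullet> b)"
      using shift that unfolding polynomial_function_iff_Basis_inner by blast
    then show ?thesis
      using real_polynomial_function_imp_sum by meson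
  qed
  then obtain a n where an: "\<And>b s. b \<in> Basis \<Longrightarrow> p (s + t) \<bullet> b = (\<Sum>i\<le>n b. a b i * s ^ i)"
    by metis
  define c where "c = (\<lambda>k. \<Sum>b\<in>Basis. (if k \<le> n b then a b k else 0) *\<^sub>R b)"
  have "(\<lambda>k. (s - t) ^ k *\<^sub>R c k) sums p s" for s
  proof -
    have "(\<lambda>k. ((s - t) ^ k * (if k \<le> n b then a b k else 0)) *\<^sub>R b) sums ((p s \<bullet> b) *\<^sub>R b)"
      if b: "b \<in> Basis" for b
    proof -
      have "(\<lambda>k. (s - t) ^ k * (if k \<le> n b then a b k else 0)) sums
          (\<Sum>k\<le>n b. (s - t) ^ k * (if k \<le> n b then a b k else 0))"
        by (rule sums_finite) auto
      also have "(\<Sum>k\<le>n b. (s - t) ^ k * (if k \<le> n b then a b k else 0)) = p s \<bullet> b"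
        using an[OF b, of "s - t"] by (simp add: mult.commute)
      finally show ?thesis by (rule sums_scaleR_left)
    qed
    then have "(\<lambda>k. \<Sum>b\<in>Basis. ((s - t) ^ k * (if k \<le> n b then a b k else 0)) *\<^sub>R b) sums
        (\<Sum>b\<in>Basis. (p s \<bullet> b) *\<^sub>R b)"
      by (rule sums_sum)
    then show ?thesis
      by (simp add: c_def euclidean_representation scaleR_sum_right)
  qed
  then show "\<exists>r>0. \<exists>a. \<forall>s\<in>ball t r. (\<lambda>k. (s - t) ^ k *\<^sub>R a k) sums p s"
    by (intro exI[of _ 1] conjI exI[of _ c]) auto
qed

lemma polynomial_image_connected_by_analytic_paths:
  fixes f :: "'a::real_normed_vector \<Rightarrow> 'b::euclidean_space"
  assumes "polynomial_function f" "convex K"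
  shows "connected_by_analytic_paths (f ` K)"
  unfolding connected_by_analytic_paths_def
proof (intro ballI)
  fix p q assume "p \<in> f ` K" "q \<in> f ` K"
  then obtain x y where xy: "x \<in> K" "y \<in> K" "p = f x" "q = f y" by blast
  define g where "g = (\<lambda>t. f ((1 - t) *\<^sub>R x + t *\<^sub>R y))"
  have "polynomial_function g"
    unfolding g_def by (rule polynomial_function_comp[OF assms(1)]) (intro polynomial_function_intros)
  then have "g real_analytic_on UNIV"
    by (rule polynomial_function_real_analytic)
  then have "analytic_path g"
    unfolding analytic_path_def by (intro exI[of _ UNIV] exI[of _ g]) auto
  moreover have "path_image g \<subseteq> f ` K"
    unfolding path_image_def g_def using xy assms(2) by (auto simp: convex_alt)
  moreover have "pathstart g = p" "pathfinish g = q"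
    by (auto simp: g_def xy pathstart_def pathfinish_def)
  ultimately show "\<exists>g. analytic_path g \<and> path_image g \<subseteq> f ` K \<and> pathstart g = p \<and> pathfinish g = q"
    by blast
qed

theorem theorem1p3:
  fixes S :: "(real ^ 'n) set" and \<P> :: "(real ^ 'n) set set"
  assumes "finite \<P>" and "\<P> \<noteq> {}"
    and "\<And>P. P \<in> \<P> \<Longrightarrow> polyhedron P \<and> compact P \<and> aff_dim P = int CARD('n)"
    and "S = \<Union>\<P>"
    and "CARD('m::finite) = CARD('n) + 1"
  shows "connected_by_analytic_paths S \<longleftrightarrow>
    (\<exists>f :: real ^ 'm \<Rightarrow> real ^ 'n. polynomial_function f \<and> f ` cball 0 1 = S)"
proof
  assume "connected_by_analytic_paths S"
  moreover have "polytope P \<and> interior P \<noteq> {}" if "P \<in> \<P>" for P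
  proof -
    have P: "polyhedron P" "compact P" "aff_dim P = int DIM(real ^ 'n)"
      using assms(3)[OF that] by auto
    then have "polytope P"
      by (simp add: polytope_eq_bounded_polyhedron compact_imp_bounded)
    moreover have "interior P = rel_interior P"
      using P(3) rel_interior_interior[of P] aff_dim_eq_full[of P] by simp
    moreover have "P \<noteq> {}" using P(3) by auto
    ultimately show ?thesis
      using rel_interior_eq_empty[of P] polytope_imp_convex[of P] by simp
  qed
  ultimately show "\<exists>f :: real ^ 'm \<Rightarrow> real ^ 'n. polynomial_function f \<and> f ` cball 0 1 = S"
    unfolding assms(4) using assms(5) by (intro polynomial_image_of_ball[OF assms(1,2)]) auto
next
  assume "\<exists>f :: real ^ 'm \<Rightarrow> real ^ 'n. polynomial_function f \<and> f ` cball 0 1 = S"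
  then show "connected_by_analytic_paths S"
    using polynomial_image_connected_by_analytic_paths[OF _ convex_cball] by metis
qed

end
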